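(* Let $E$ be a finitely or countably generated Hilbert $A$-module over a unital $C^*$-algebra $A$, and let $X=\{x_n\}$ be a standard frame for $E$ with bounds $C$ and $D$. Suppose that $Y=\{y_n\}$ is a sequence in $E$ and that there exists a positive constant $$\lambda<\frac{1}{D}\left(\frac{CD^2-C^2D}{C^2+D^2}\right)^2$$ such that for every $x\in E$ $$\Big\|\sum_n\langle x,x_n-y_n\rangle\langle x_n-y_n,x\rangle\Big\|\le\lambda\|x\|^2 .$$ Moreover, suppose that $U$ is a non-zero adjointable operator on $\ell^2(A)$ with $\|U-I\|<\dfrac{C^2}{D^2}$. Then $Y=\{y_n\}$ is a standard frame for $E$ and the multiplier $\mathbf{M}_{U,X,Y}=T_X^*UT_Y:E\to E$ is invertible.
   Context: Hilbert $A$-modules are left modules whose $A$-valued inner product is $A$-linear in the first argument. $\ell^2(A)$ is the Hilbert $A$-module of sequences $\{a_n\}$ in $A$ such that $\sum_n a_na_n^*$ converges in norm, with $\langle\{a_n\},\{b_n\}\rangle=\sum_n a_nb_n^*$. $I$ is the identity operator on $\ell^2(A)$. A sequence $\{x_n\}\subset E$ is a standard frame if there are constants $C,D>0$ such that for every $x\in E$ the series $\sum_n\langle x,x_n\rangle\langle x_n,x\rangle$ converges in norm and $C\langle x,x\rangle\le\sum_n\langle x,x_n\rangle\langle x_n,x\rangle\le D\langle x,x\rangle$. The optimal constants (maximal $C$, minimal $D$) are called the frame bounds. For a standard frame $X=\{x_n\}$, the analysis operator is $T_X:E\to\ell^2(A)$, $T_Xx=\{\langle x,x_n\rangle\}_n$;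 it is adjointable with adjoint (synthesis operator) $T_X^*(\{a_n\})=\sum_n a_nx_n$. For standard frames $X,Y$ of $E$, $\mathbf{M}_{U,X,Y}=T_X^*UT_Y$. Invertible means bijective with bounded inverse. *)

theory Defs
  imports "HOL-Analysis.Analysis"
begin

section \<open>Unital \<open>C\<^sup>*\<close>-algebras\<close>

text \<open>
  \<open>norm 1 = 1\<close> is inherited from \<^class>\<open>real_normed_algebra_1\<close>; it holds in every unital
  \<open>C\<^sup>*\<close>-algebra other than the zero algebra. Only the latter is excluded, and over the zero
  algebra there is no non-zero operator on \<open>\<ell>\<^sup>2(A)\<close>.
\<close>

class cstar_algebra = real_normed_algebra_1 + banach +
  fixes scaleC :: "complex \<Rightarrow> 'a \<Rightarrow> 'a"  (infixr \<open>*\<^sub>C\<close> 75)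
    and star :: "'a \<Rightarrow> 'a"
  assumes scaleC_add_right: "z *\<^sub>C (a + b) = z *\<^sub>C a + z *\<^sub>C b"
    and scaleC_add_left: "(z + w) *\<^sub>C a = z *\<^sub>C a + w *\<^sub>C a"
    and scaleC_scaleC: "z *\<^sub>C w *\<^sub>C a = (z * w) *\<^sub>C a"
    and scaleC_of_real: "complex_of_real r *\<^sub>C a = r *\<^sub>R a"
    and scaleC_mult_left: "(z *\<^sub>C a) * b = z *\<^sub>C (a * b)"
    and scaleC_mult_right: "a * (z *\<^sub>C b) = z *\<^sub>C (a * b)"
    and norm_scaleC: "norm (z *\<^sub>C a) = cmod z * norm a"
    and star_add: "star (a + b) = star a + star b"
    and star_scaleC: "star (z *\<^sub>C a) = cnj z *\<^sub>C star a"
    and star_mult: "star (a * b) = star b * star a"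
    and star_star: "star (star a) = a"
    and cstar_identity: "norm (star a * a) = (norm a)\<^sup>2"

definition spectrum :: "'a::cstar_algebra \<Rightarrow> complex set" where
  "spectrum a = {z. \<not> (\<exists>b. b * (z *\<^sub>C 1 - a) = 1 \<and> (z *\<^sub>C 1 - a) * b = 1)}"

definition positive :: "'a::cstar_algebra \<Rightarrow> bool" where
  "positive a \<longleftrightarrow> star a = a \<and> spectrum a \<subseteq> \<real>\<^sub>\<ge>\<^sub>0"

definition cstar_le :: "'a::cstar_algebra \<Rightarrow> 'a \<Rightarrow> bool"  (infix \<open>\<preceq>\<close> 50) where
  "a \<preceq> b \<longleftrightarrow> positive (b - a)"


section \<open>Hilbert modules\<close>

text \<open>
  The module is the whole type \<open>'e\<close>. Completeness comes from \<^class>\<open>banach\<close>; \<open>norm_ip\<close> says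
  that the norm of the type is the one induced by the \<open>A\<close>-valued inner product. As \<open>A\<close> is
  unital, complex scalars act through \<open>z *\<^sub>C 1\<close>, and \<open>smul_of_real\<close> says that the real scalar
  multiplication of the type is the restriction of this action.
\<close>

locale hilbert_module =
  fixes smul :: "'a::cstar_algebra \<Rightarrow> 'e::banach \<Rightarrow> 'e"
    and ip :: "'e \<Rightarrow> 'e \<Rightarrow> 'a"
  assumes smul_add_right: "smul a (x + y) = smul a x + smul a y"
    and smul_add_left: "smul (a + b) x = smul a x + smul b x"
    and smul_smul: "smul a (smul b x) = smul (a * b) x"
    and smul_one: "smul 1 x = x"
    and smul_of_real: "smul (r *\<^sub>R 1) x = r *\<^sub>R x"
    and ip_add_left: "ip (x + y) z = ip x z + ip y z"
    and ip_smul_left: "ip (smul a x) y = a * ip x y"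
    and ip_star: "ip y x = star (ip x y)"
    and ip_positive: "positive (ip x x)"
    and ip_definite: "ip x x = 0 \<Longrightarrow> x = 0"
    and norm_ip: "norm x = sqrt (norm (ip x x))"

definition module_hull :: "('a::cstar_algebra \<Rightarrow> 'e::banach \<Rightarrow> 'e) \<Rightarrow> 'e set \<Rightarrow> 'e set" where
  "module_hull smul S = {\<Sum>s\<in>F. smul (a s) s | F a. finite F \<and> F \<subseteq> S}"

definition finitely_generated :: "('a::cstar_algebra \<Rightarrow> 'e::banach \<Rightarrow> 'e) \<Rightarrow> bool" where
  "finitely_generated smul \<longleftrightarrow> (\<exists>S. finite S \<and> module_hull smul S = UNIV)"

definition countably_generated :: "('a::cstar_algebra \<Rightarrow> 'e::banach \<Rightarrow> 'e) \<Rightarrow> bool" where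
  "countably_generated smul \<longleftrightarrow> (\<exists>S. countable S \<and> closure (module_hull smul S) = UNIV)"

definition invertible_operator :: "('e::banach \<Rightarrow> 'e) \<Rightarrow> bool" where
  "invertible_operator T \<longleftrightarrow> bij T \<and> bounded_linear (inv T)"


section \<open>The Hilbert module of square-summable sequences\<close>

text \<open>
  \<open>\<ell>\<^sup>2(A)\<close> is a set of sequences; operators on it are functions on all sequences whose values
  outside this set are irrelevant.
\<close>

definition ell2 :: "(nat \<Rightarrow> 'a::cstar_algebra) set" where
  "ell2 = {a. summable (\<lambda>n. a n * star (a n))}"

definition ell2_ip :: "(nat \<Rightarrow> 'a::cstar_algebra) \<Rightarrow> (nat \<Rightarrow> 'a) \<Rightarrow> 'a" where
  "ell2_ip a b = (\<Sum>n. a n * star (b n))"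

definition ell2_norm :: "(nat \<Rightarrow> 'a::cstar_algebra) \<Rightarrow> real" where
  "ell2_norm a = sqrt (norm (ell2_ip a a))"

definition ell2_adjointable :: "((nat \<Rightarrow> 'a::cstar_algebra) \<Rightarrow> (nat \<Rightarrow> 'a)) \<Rightarrow> bool" where
  "ell2_adjointable U \<longleftrightarrow> U \<in> ell2 \<rightarrow> ell2 \<and>
     (\<exists>V \<in> ell2 \<rightarrow> ell2. \<forall>a\<in>ell2. \<forall>b\<in>ell2. ell2_ip (U a) b = ell2_ip a (V b))"

text \<open>
  The operator norm takes extended real values, so that it is \<open>\<infinity>\<close> on unbounded maps; a supremum
  in \<open>\<real>\<close> would be unspecified there.
\<close>

definition ell2_opnorm :: "((nat \<Rightarrow> 'a::cstar_algebra) \<Rightarrow> (nat \<Rightarrow> 'a)) \<Rightarrow> ereal" where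
  "ell2_opnorm T = (SUP a\<in>{a\<in>ell2. ell2_norm a \<le> 1}. ereal (ell2_norm (T a)))"


section \<open>Standard frames and multipliers\<close>

definition frame_inequalities ::
  "('e::banach \<Rightarrow> 'e \<Rightarrow> 'a::cstar_algebra) \<Rightarrow> (nat \<Rightarrow> 'e) \<Rightarrow> real \<Rightarrow> real \<Rightarrow> bool" where
  "frame_inequalities ip X C D \<longleftrightarrow> 0 < C \<and> 0 < D \<and>
     (\<forall>x. summable (\<lambda>n. ip x (X n) * ip (X n) x) \<and>
          C *\<^sub>R ip x x \<preceq> (\<Sum>n. ip x (X n) * ip (X n) x) \<and>
          (\<Sum>n. ip x (X n) * ip (X n) x) \<preceq> D *\<^sub>R ip x x)"

definition standard_frame ::
  "('e::banach \<Rightarrow> 'e \<Rightarrow> 'a::cstar_algebra) \<Rightarrow> (nat \<Rightarrow> 'e) \<Rightarrow> bool" where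
  "standard_frame ip X \<longleftrightarrow> (\<exists>C D. frame_inequalities ip X C D)"

text \<open>The frame bounds are the optimal constants: \<open>C\<close> is maximal and \<open>D\<close> is minimal.\<close>

definition frame_bounds ::
  "('e::banach \<Rightarrow> 'e \<Rightarrow> 'a::cstar_algebra) \<Rightarrow> (nat \<Rightarrow> 'e) \<Rightarrow> real \<Rightarrow> real \<Rightarrow> bool" where
  "frame_bounds ip X C D \<longleftrightarrow> frame_inequalities ip X C D \<and>
     (\<forall>C' D'. frame_inequalities ip X C' D' \<longrightarrow> C' \<le> C \<and> D \<le> D')"

definition analysis ::
  "('e::banach \<Rightarrow> 'e \<Rightarrow> 'a::cstar_algebra) \<Rightarrow> (nat \<Rightarrow> 'e) \<Rightarrow> 'e \<Rightarrow> nat \<Rightarrow> 'a" where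
  "analysis ip X x = (\<lambda>n. ip x (X n))"

definition synthesis ::
  "('a::cstar_algebra \<Rightarrow> 'e::banach \<Rightarrow> 'e) \<Rightarrow> (nat \<Rightarrow> 'e) \<Rightarrow> (nat \<Rightarrow> 'a) \<Rightarrow> 'e" where
  "synthesis smul X a = (\<Sum>n. smul (a n) (X n))"

definition multiplier ::
  "('a::cstar_algebra \<Rightarrow> 'e::banach \<Rightarrow> 'e) \<Rightarrow> ('e \<Rightarrow> 'e \<Rightarrow> 'a) \<Rightarrow>
   ((nat \<Rightarrow> 'a) \<Rightarrow> (nat \<Rightarrow> 'a)) \<Rightarrow> (nat \<Rightarrow> 'e) \<Rightarrow> (nat \<Rightarrow> 'e) \<Rightarrow> 'e \<Rightarrow> 'e" where
  "multiplier smul ip U X Y = synthesis smul X \<circ> U \<circ> analysis ip Y"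

end

theory Submission
  imports Defs
begin

text \<open>
  Let \<open>S = T\<^sub>X\<^sup>* T\<^sub>X\<close> be the frame operator of \<open>X\<close>. Since \<open>C \<le> S \<le> D\<close>, one has
  \<open>\<parallel>I - D\<^sup>-\<^sup>1 S\<parallel> \<le> 1 - C / D\<close>, and writing \<open>T\<^sub>Y = T\<^sub>X - T\<^bsub>X-Y\<^esub>\<close>, \<open>U = I + (U - I)\<close> gives
  \<open>\<parallel>S - M\<parallel> \<le> \<surd>D (\<parallel>U - I\<parallel> \<surd>D + \<parallel>U\<parallel> \<surd>\<lambda>)\<close> for the multiplier \<open>M\<close>; the bound on \<open>\<lambda>\<close> is
  exactly what makes this smaller than \<open>C\<close>. Hence \<open>\<parallel>I - D\<^sup>-\<^sup>1 M\<parallel> < 1\<close> and \<open>M\<close> is invertible.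
  In particular \<open>\<parallel>x\<parallel> \<le> c \<parallel>T\<^sub>Y x\<parallel>\<close>, and Paschke's inequality turns such norm bounds for
  \<open>A\<close>-linear maps into the \<open>A\<close>-valued frame inequalities.

  As positivity is defined through the spectrum, the order theory of \<open>C\<^sup>*\<close>-algebras is needed up to
  square roots and \<open>a a\<^sup>* \<ge> 0\<close>. That the norm of a self-adjoint element is its spectral radius is
  obtained without analytic functions, from uniform continuity of the resolvent on the closed disc.
\<close>

section \<open>Elementary properties of the involution\<close>

lemma star_zero [simp]: "star (0::'a::cstar_algebra) = 0"
  using star_add[of "0::'a" 0] by simp

lemma star_one [simp]: "star (1::'a::cstar_algebra) = 1"
  using star_mult[of "1::'a" "star 1"] by (simp add: star_star)

lemma star_scaleR: "star (r *\<^sub>R a) = r *\<^sub>R star (a::'a::cstar_algebra)"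
  by (metis complex_cnj_complex_of_real scaleC_of_real star_scaleC)

lemma star_minus: "star (- a) = - star (a::'a::cstar_algebra)"
  using star_scaleR[of "-1" a] by simp

lemma star_diff: "star (a - b) = star a - star (b::'a::cstar_algebra)"
  using star_add[of a "- b"] by (simp add: star_minus)

lemma star_sum: "star (sum f S) = (\<Sum>i\<in>S. star (f i :: 'a::cstar_algebra))"
  by (induction S rule: infinite_finite_induct) (auto simp: star_add)

text \<open>The C*-identity and submultiplicativity give
  \<open>norm b * norm b \<le> norm (star b) * norm b\<close>; the reverse bound is the same one at
  \<open>star a\<close>.\<close>

lemma norm_star [simp]: "norm (star a) = norm (a::'a::cstar_algebra)"
proof -
  have le: "norm b \<le> norm (star b)" for b :: 'a
  proof (cases "b = 0")
    case False
    have "norm b * norm b \<le> norm (star b) * norm b"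
      using norm_mult_ineq[of "star b" b] by (simp add: cstar_identity power2_eq_square)
    then show ?thesis using False by simp
  qed simp
  show ?thesis using le[of a] le[of "star a"] by (simp add: star_star)
qed

lemma norm_mult_star: "norm (a * star a) = (norm (a::'a::cstar_algebra))\<^sup>2"
  using cstar_identity[of "star a"] by (simp add: star_star)

lemma norm_selfadjoint_square: "star a = a \<Longrightarrow> norm (a * a) = (norm (a::'a::cstar_algebra))\<^sup>2"
  using cstar_identity[of a] by simp

lemma bounded_linear_star: "bounded_linear (star :: 'a::cstar_algebra \<Rightarrow> 'a)"
  by (rule bounded_linear_intro[where K = 1]) (auto simp: star_add star_scaleR)

lemmas tendsto_star = bounded_linear.tendsto[OF bounded_linear_star]

section \<open>Arithmetic of complex scalars\<close>

lemma scaleC_zero_left [simp]: "0 *\<^sub>C (a::'a::cstar_algebra) = 0"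
  using scaleC_of_real[of 0 a] by simp

lemma scaleC_one [simp]: "1 *\<^sub>C (a::'a::cstar_algebra) = a"
  using scaleC_of_real[of 1 a] by simp

lemma scaleC_zero_right [simp]: "z *\<^sub>C (0::'a::cstar_algebra) = 0"
  using scaleC_add_right[of z "0::'a" 0] by simp

lemma scaleC_minus_right: "z *\<^sub>C (- a) = - (z *\<^sub>C (a::'a::cstar_algebra))"
  using scaleC_add_right[of z a "- a"] by (simp add: add_eq_0_iff)

lemma scaleC_diff_right: "z *\<^sub>C (a - b) = z *\<^sub>C a - z *\<^sub>C (b::'a::cstar_algebra)"
  using scaleC_add_right[of z a "- b"] by (simp add: scaleC_minus_right)

lemma scaleC_minus_left: "(- z) *\<^sub>C a = - (z *\<^sub>C (a::'a::cstar_algebra))"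
  using scaleC_add_left[of z "- z" a] by (simp add: add_eq_0_iff)

lemma scaleC_diff_left: "(z - w) *\<^sub>C a = z *\<^sub>C a - w *\<^sub>C (a::'a::cstar_algebra)"
  using scaleC_add_left[of z "- w" a] by (simp add: scaleC_minus_left)

section \<open>Invertible elements and the spectrum\<close>

definition two_sided_unit :: "'a::monoid_mult \<Rightarrow> bool" where
  "two_sided_unit a \<longleftrightarrow> (\<exists>b. b * a = 1 \<and> a * b = 1)"

text \<open>Meaningful only on invertible elements, where uniqueness of inverses makes the choice
  immaterial.\<close>

definition unit_inv :: "'a::monoid_mult \<Rightarrow> 'a" where
  "unit_inv a = (SOME b. b * a = 1 \<and> a * b = 1)"

lemma unit_inv:
  assumes "two_sided_unit a"
  shows "unit_inv a * a = 1" "a * unit_inv a = 1"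
  using someI_ex[OF assms[unfolded two_sided_unit_def]] by (auto simp: unit_inv_def)

lemma unit_inv_unique:
  assumes "b * a = 1" "a * b = (1::'a::monoid_mult)"
  shows "unit_inv a = b"
proof -
  have u: "two_sided_unit a" using assms by (auto simp: two_sided_unit_def)
  have "unit_inv a = unit_inv a * (a * b)" using assms by simp
  also have "\<dots> = b" using unit_inv[OF u] by (simp flip: mult.assoc)
  finally show ?thesis .
qed

lemma spectrum_iff: "z \<in> spectrum a \<longleftrightarrow> \<not> two_sided_unit (z *\<^sub>C 1 - a)"
  by (auto simp: spectrum_def two_sided_unit_def)

lemma neumann:
  fixes a :: "'a::{real_normed_algebra_1,banach}"
  assumes "norm a < 1"
  shows "two_sided_unit (1 - a)"
proof -
  define b where "b = (\<Sum>n. a ^ n)"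
  have s: "summable (\<lambda>n. a ^ n)" by (rule complete_algebra_summable_geometric[OF assms])
  have 1: "(\<Sum>n. a ^ Suc n) = b - 1"
    using suminf_split_head[OF s] by (simp add: b_def)
  have "a * b = (\<Sum>n. a ^ Suc n)"
    unfolding b_def by (simp add: suminf_mult[OF s])
  moreover have "b * a = (\<Sum>n. a ^ Suc n)"
    unfolding b_def by (simp add: suminf_mult2[OF s] power_commutes)
  ultimately show ?thesis
    unfolding two_sided_unit_def 1 by (intro exI[of _ b]) (simp add: algebra_simps)
qed

lemma two_sided_unit_mult:
  assumes "two_sided_unit (a::'a::monoid_mult)" "two_sided_unit b"
  shows "two_sided_unit (a * b)"
proof -
  have "(unit_inv b * unit_inv a) * (a * b) = unit_inv b * (unit_inv a * a) * b"
    by (simp only: mult.assoc)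
  moreover have "(a * b) * (unit_inv b * unit_inv a) = a * (b * unit_inv b) * unit_inv a"
    by (simp only: mult.assoc)
  ultimately show ?thesis
    using assms unfolding two_sided_unit_def[of "a * b"]
    by (intro exI[of _ "unit_inv b * unit_inv a"]) (simp add: unit_inv)
qed

lemma two_sided_unit_scaleC_iff:
  assumes "z \<noteq> 0"
  shows "two_sided_unit (z *\<^sub>C (a::'a::cstar_algebra)) \<longleftrightarrow> two_sided_unit a"
proof -
  have *: "two_sided_unit (w *\<^sub>C b)" if "two_sided_unit b" "w \<noteq> 0" for w and b :: 'a
    using unit_inv[OF that(1)] that(2) unfolding two_sided_unit_def
    by (intro exI[of _ "(1 / w) *\<^sub>C unit_inv b"])
      (simp add: scaleC_mult_left scaleC_mult_right scaleC_scaleC)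
  show ?thesis
    using *[of a z] *[of "z *\<^sub>C a" "1 / z"] assms by (auto simp: scaleC_scaleC)
qed

text \<open>For \<open>cmod z > norm a\<close> the element \<open>z 1 - a\<close> is
  \<open>z\<close> times \<open>1 - a / z\<close>, which a Neumann series inverts.\<close>

lemma spectrum_norm_le:
  assumes "z \<in> spectrum (a::'a::cstar_algebra)"
  shows "cmod z \<le> norm a"
proof (rule ccontr)
  assume "\<not> ?thesis"
  then have lt: "norm a < cmod z" by simp
  then have z: "z \<noteq> 0" by auto
  have "norm ((1 / z) *\<^sub>C a) < 1"
    using lt z by (simp add: norm_scaleC norm_divide divide_simps)
  then have "two_sided_unit (1 - (1 / z) *\<^sub>C a)" by (rule neumann)
  then have "two_sided_unit (z *\<^sub>C (1 - (1 / z) *\<^sub>C a))"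
    by (simp add: two_sided_unit_scaleC_iff z)
  then show False using assms z by (simp add: spectrum_iff scaleC_diff_right scaleC_scaleC)
qed

lemma spectrum_scaleC: "z \<noteq> 0 \<Longrightarrow> z * w \<in> spectrum (z *\<^sub>C a) \<longleftrightarrow> w \<in> spectrum (a::'a::cstar_algebra)"
  using two_sided_unit_scaleC_iff[of z "w *\<^sub>C 1 - a"]
  by (simp add: spectrum_iff scaleC_scaleC scaleC_diff_right)

lemma spectrum_shift: "z + w \<in> spectrum (w *\<^sub>C 1 + a) \<longleftrightarrow> z \<in> spectrum a"
  by (simp add: spectrum_iff scaleC_add_left)

lemma spectrum_minus: "- z \<in> spectrum (- a) \<longleftrightarrow> z \<in> spectrum a"
  using two_sided_unit_scaleC_iff[of "-1" "z *\<^sub>C 1 - a"]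
  by (simp add: spectrum_iff scaleC_minus_left)

text \<open>Shift by \<open>i t\<close> with \<open>t\<close> real: the spectral point becomes
  \<open>z + i t\<close>, while the C*-identity bounds the squared norm of \<open>a + i t\<close> by
  \<open>t^2 + norm a ^ 2\<close>. The terms in \<open>t^2\<close> cancel and leave a linear
  expression in \<open>t\<close> that is bounded above, so its slope \<open>2 * Im z\<close> is
  zero.\<close>

lemma spectrum_selfadjoint_real:
  assumes "star a = a" "z \<in> spectrum a"
  shows "Im z = 0"
proof (rule ccontr)
  assume y: "Im z \<noteq> 0"
  have b: "2 * t * Im z \<le> (norm a)\<^sup>2" for t
  proof -
    let ?w = "\<i> * complex_of_real t"
    have "z + ?w \<in> spectrum (?w *\<^sub>C 1 + a)" using assms(2) by (simp add: spectrum_shift)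
    then have "cmod (z + ?w) \<le> norm (?w *\<^sub>C 1 + a)" by (rule spectrum_norm_le)
    then have "(cmod (z + ?w))\<^sup>2 \<le> (norm (?w *\<^sub>C 1 + a))\<^sup>2" by simp
    also have "\<dots> = norm (star (?w *\<^sub>C 1 + a) * (?w *\<^sub>C 1 + a))" by (simp add: cstar_identity)
    also have "star (?w *\<^sub>C 1 + a) * (?w *\<^sub>C 1 + a) = (t\<^sup>2) *\<^sub>R 1 + a * a"
    proof -
      have "star (?w *\<^sub>C 1 + a) * (?w *\<^sub>C 1 + a) = (of_real (t\<^sup>2)) *\<^sub>C 1 + a * a"
        using assms(1)
        by (simp add: star_add star_scaleC scaleC_mult_left scaleC_mult_right algebra_simps
            scaleC_scaleC scaleC_minus_left scaleC_diff_right power2_eq_square)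
      then show ?thesis by (simp only: scaleC_of_real)
    qed
    also have "norm \<dots> \<le> t\<^sup>2 + (norm a)\<^sup>2"
      by (rule order_trans[OF norm_triangle_ineq])
        (use norm_mult_ineq[of a a] in \<open>simp add: power2_eq_square\<close>)
    finally have "(Re z)\<^sup>2 + (Im z)\<^sup>2 + 2 * t * Im z \<le> (norm a)\<^sup>2"
      unfolding cmod_power2 by (simp add: power2_eq_square algebra_simps)
    then show ?thesis by (smt (verit) zero_le_power2)
  qed
  show False using b[of "((norm a)\<^sup>2 + 1) / (2 * Im z)"] y by simp
qed

section \<open>The norm of a self-adjoint element is its spectral radius\<close>

text \<open>Partial fractions: \<open>1 / (1 - b^2)\<close> is the mean of
  \<open>1 / (1 - b)\<close> and \<open>1 / (1 + b)\<close>.\<close>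

lemma unit_inv_one_minus_square:
  fixes b :: "'a::cstar_algebra"
  assumes "two_sided_unit (1 - b)" "two_sided_unit (1 + b)"
  shows "two_sided_unit (1 - b * b)"
    and "unit_inv (1 - b * b) = (1/2) *\<^sub>R (unit_inv (1 - b) + unit_inv (1 + b))"
proof -
  let ?p = "unit_inv (1 - b)" and ?q = "unit_inv (1 + b)"
  have f: "1 - b * b = (1 + b) * (1 - b)" "1 - b * b = (1 - b) * (1 + b)"
    by (simp_all add: algebra_simps)
  have 1: "(1 - b * b) * ?p = 1 + b" "(1 - b * b) * ?q = 1 - b"
    unfolding f(1)
    using unit_inv[OF assms(1)] unit_inv[OF assms(2)]
    by (simp add: mult.assoc) (metis f mult.assoc mult.right_neutral unit_inv(2)[OF assms(2)])
  have 2: "?p * (1 - b * b) = 1 + b" "?q * (1 - b * b) = 1 - b"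
    using unit_inv[OF assms(1)] unit_inv[OF assms(2)]
    by (metis f mult.assoc mult_1)+
  have e: "(1 + b) + (1 - b) = 2 *\<^sub>R 1" by (simp add: scaleR_2)
  have h: "(1/2) *\<^sub>R ((1 + b) + (1 - b)) = 1" unfolding e scaleR_scaleR by simp
  have r: "(1 - b * b) * ((1/2) *\<^sub>R (?p + ?q)) = 1"
    using h 1 by (simp add: distrib_left)
  have l: "((1/2) *\<^sub>R (?p + ?q)) * (1 - b * b) = 1"
    using h 2 by (simp add: distrib_right)
  show "two_sided_unit (1 - b * b)" unfolding two_sided_unit_def using r l by blast
  show "unit_inv (1 - b * b) = (1/2) *\<^sub>R (?p + ?q)" by (rule unit_inv_unique[OF l r])
qed

text \<open>Rests on the resolvent identity \<open>R w - R z = (w - z) (R z a R w)\<close>.\<close>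

lemma continuous_on_resolvent:
  fixes a :: "'a::cstar_algebra"
  assumes u: "\<And>z. z \<in> S \<Longrightarrow> two_sided_unit (1 - z *\<^sub>C a)"
  shows "continuous_on S (\<lambda>z. unit_inv (1 - z *\<^sub>C a))"
  unfolding continuous_on_iff
proof (intro ballI allI impI)
  fix z and e :: real assume z: "z \<in> S" and e: "0 < e"
  define R where "R w = unit_inv (1 - w *\<^sub>C a)" for w
  define K where "K = norm (R z) * norm a + 1"
  have K: "K > 0" by (simp add: K_def add_nonneg_pos)
  \<comment> \<open>The first entry of the minimum forces
    \<open>norm (R w) \<le> 2 * norm (R z)\<close>; given that, the second one makes the difference
    at most \<open>e / 2\<close>.\<close>
  define d where "d = min (1 / (2 * K)) (e / (4 * K * (norm (R z) + 1)))"
  have d: "d > 0" using K e by (simp add: d_def add_nonneg_pos)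
  have "dist (R w) (R z) < e" if w: "w \<in> S" "dist w z < d" for w
  proof -
    have id: "R w - R z = (w - z) *\<^sub>C (R z * (a * R w))"
    proof -
      have "R z * ((1 - z *\<^sub>C a) - (1 - w *\<^sub>C a)) * R w = (w - z) *\<^sub>C (R z * (a * R w))"
        by (simp add: scaleC_mult_left scaleC_mult_right mult.assoc flip: scaleC_diff_left)
      moreover have "R z * ((1 - z *\<^sub>C a) - (1 - w *\<^sub>C a)) * R w
          = (R z * (1 - z *\<^sub>C a)) * R w - R z * ((1 - w *\<^sub>C a) * R w)"
        by (simp only: right_diff_distrib left_diff_distrib mult.assoc)
      ultimately show ?thesis using unit_inv[OF u[OF z]] unit_inv[OF u[OF w(1)]]
        by (simp add: R_def)
    qed
    have n: "norm (R w - R z) \<le> cmod (w - z) * (K * norm (R w))"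
    proof -
      have "norm (R z * (a * R w)) \<le> norm (R z) * (norm a * norm (R w))"
        by (meson mult_left_mono norm_ge_zero norm_mult_ineq order_trans)
      also have "\<dots> \<le> K * norm (R w)" by (simp add: K_def algebra_simps)
      finally show ?thesis unfolding id norm_scaleC by (simp add: mult_left_mono)
    qed
    have wz: "cmod (w - z) < d" using w(2) by (simp add: dist_norm)
    have "cmod (w - z) * K \<le> 1/2"
      using wz K by (simp add: d_def field_simps)
    then have "cmod (w - z) * K * norm (R w) \<le> 1/2 * norm (R w)" by (rule mult_right_mono) simp
    then have h: "norm (R w - R z) \<le> norm (R w) / 2" using n by (simp add: mult.assoc)
    have b: "norm (R w) \<le> 2 * norm (R z)"
      using h norm_triangle_ineq2[of "R w" "R z"] by simp
    have "norm (R w - R z) \<le> cmod (w - z) * (K * (2 * (norm (R z) + 1)))"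
      by (rule order_trans[OF n]) (use b K in \<open>intro mult_left_mono; simp\<close>)
    also have "\<dots> \<le> d * (K * (2 * (norm (R z) + 1)))"
      using wz K by (intro mult_right_mono) auto
    also have "\<dots> \<le> e / (4 * K * (norm (R z) + 1)) * (K * (2 * (norm (R z) + 1)))"
      using K by (intro mult_right_mono) (auto simp: d_def)
    also have "\<dots> = e / 2"
    proof -
      have "e / (4 * K * N) * (K * (2 * N)) = e / 2" if "N \<noteq> 0" for N
        using K that by simp
      moreover have "norm (R z) + 1 \<noteq> 0" by (smt (verit) norm_ge_zero)
      ultimately show ?thesis by blast
    qed
    also have "\<dots> < e" using e by simp
    finally show ?thesis by (simp add: dist_norm)
  qed
  then show "\<exists>d>0. \<forall>w\<in>S. dist w z < d \<longrightarrow>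
      dist (unit_inv (1 - w *\<^sub>C a)) (unit_inv (1 - z *\<^sub>C a)) < e"
    using d unfolding R_def by blast
qed

text \<open>Averaging the resolvent over \<open>\<plusminus>v\<close> with \<open>v\<^sup>2 = w\<close> gives the resolvent of the square, so
  a bound on its oscillation survives repeated squaring.\<close>

lemma resolvent_oscillation_power:
  fixes a :: "'a::cstar_algebra"
  assumes "\<And>w. cmod w = 1 \<Longrightarrow> two_sided_unit (1 - w *\<^sub>C a)
      \<and> two_sided_unit (1 - (complex_of_real t * w) *\<^sub>C a)
      \<and> norm (unit_inv (1 - w *\<^sub>C a) - unit_inv (1 - (complex_of_real t * w) *\<^sub>C a)) \<le> e"
    and "cmod w = 1"
  shows "two_sided_unit (1 - w *\<^sub>C a ^ 2 ^ k)
      \<and> two_sided_unit (1 - (complex_of_real (t ^ 2 ^ k) * w) *\<^sub>C a ^ 2 ^ k)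
      \<and> norm (unit_inv (1 - w *\<^sub>C a ^ 2 ^ k)
          - unit_inv (1 - (complex_of_real (t ^ 2 ^ k) * w) *\<^sub>C a ^ 2 ^ k)) \<le> e"
  using assms(2)
proof (induction k arbitrary: w)
  case 0
  then show ?case using assms(1) by simp
next
  case (Suc k)
  define b where "b = a ^ 2 ^ k"
  define s where "s = complex_of_real (t ^ 2 ^ k)"
  \<comment> \<open>Both square roots \<open>v\<close> and \<open>- v\<close> of \<open>w\<close>
    lie on the unit circle, so the induction hypothesis covers both factors of
    \<open>1 - w b^2\<close>, and likewise both factors of \<open>1 - s^2 w b^2\<close>.\<close>
  define v where "v = csqrt w"
  have vv: "v * v = w" by (simp add: v_def flip: power2_eq_square)
  then have "cmod v * cmod v = 1" using Suc.prems by (simp flip: norm_mult)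
  then have v: "cmod v = 1" by (metis abs_norm_cancel abs_square_eq_1 power2_eq_square)
  have b2: "a ^ 2 ^ Suc k = b * b" by (simp add: b_def power_mult_distrib mult_2 flip: power_add)
  have s2: "complex_of_real (t ^ 2 ^ Suc k) = s * s"
    by (simp add: s_def power_mult_distrib mult_2 flip: power_add)
  have sq: "(v *\<^sub>C b) * (v *\<^sub>C b) = w *\<^sub>C (b * b)"
    "((s * v) *\<^sub>C b) * ((s * v) *\<^sub>C b) = (s * s * w) *\<^sub>C (b * b)"
    using vv by (simp_all add: scaleC_mult_left scaleC_mult_right scaleC_scaleC ac_simps)
  note p = Suc.IH[OF v, folded b_def s_def]
  have "cmod (- v) = 1" using v by simp
  note m = Suc.IH[OF this, folded b_def s_def, unfolded mult_minus_right scaleC_minus_left diff_minus_eq_add]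
  note u1 = unit_inv_one_minus_square[of "v *\<^sub>C b", unfolded sq]
  note u2 = unit_inv_one_minus_square[of "(s * v) *\<^sub>C b", unfolded sq]
  let ?P = "unit_inv (1 - v *\<^sub>C b)" and ?Q = "unit_inv (1 + v *\<^sub>C b)"
  let ?P' = "unit_inv (1 - (s * v) *\<^sub>C b)" and ?Q' = "unit_inv (1 + (s * v) *\<^sub>C b)"
  have "norm ((?P - ?P') + (?Q - ?Q')) \<le> e + e"
    using p m by (intro norm_triangle_mono) auto
  then have "norm ((1/2) *\<^sub>R ((?P - ?P') + (?Q - ?Q'))) \<le> e" by simp
  also have "(1/2) *\<^sub>R ((?P - ?P') + (?Q - ?Q')) = (1/2) *\<^sub>R (?P + ?Q) - (1/2) *\<^sub>R (?P' + ?Q')"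
    by (simp add: algebra_simps)
  finally show ?case unfolding b2 s2 using u1 u2 p m by simp
qed

lemma selfadjoint_power: "star a = a \<Longrightarrow> star (a ^ n) = (a::'a::cstar_algebra) ^ n"
  by (induction n) (auto simp: star_mult power_commutes)

lemma norm_selfadjoint_power:
  assumes "star a = (a::'a::cstar_algebra)"
  shows "norm (a ^ 2 ^ k) = norm a ^ 2 ^ k"
proof (induction k)
  case (Suc k)
  have "a ^ 2 ^ Suc k = a ^ 2 ^ k * a ^ 2 ^ k" by (simp add: mult_2 flip: power_add)
  then show ?case
    using Suc norm_selfadjoint_square[OF selfadjoint_power[OF assms, of "2 ^ k"]]
    by (simp add: mult.commute flip: power_mult)
qed simp

text \<open>Otherwise \<open>1 - z a\<close> is invertible on the whole closed disc with a uniformly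
  continuous inverse, so the inverses at \<open>w\<close> and \<open>t w\<close> are close for
  \<open>w\<close> on the circle and some \<open>t < 1\<close>. Squaring repeatedly keeps them close
  and replaces \<open>t\<close> by a small power of itself. The inner inverse is then near 1, hence
  so is the outer one, although the power of \<open>a\<close> still has norm 1.\<close>

lemma spectral_radius_attained:
  fixes a :: "'a::cstar_algebra"
  assumes sa: "star a = a" and n1: "norm a = 1"
  shows "1 \<in> spectrum a \<or> -1 \<in> spectrum a"
proof (rule ccontr)
  assume "\<not> ?thesis"
  then have ns: "1 \<notin> spectrum a" "-1 \<notin> spectrum a" by auto
  have u: "two_sided_unit (1 - z *\<^sub>C a)" if z: "cmod z \<le> 1" for z
  proof (cases "z = 0")
    case False
    have "1 / z \<notin> spectrum a"
    proof
      assume i: "1 / z \<in> spectrum a"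
      have "cmod (1 / z) = 1"
        using spectrum_norm_le[OF i] z False n1 by (simp add: norm_divide divide_simps split: if_splits)
      moreover have "Im (1 / z) = 0" using spectrum_selfadjoint_real[OF sa i] .
      ultimately have "1 / z = 1 \<or> 1 / z = -1"
        by (metis abs_1 abs_eq_iff cmod_eq_Re complex_eq_iff one_complex.sel uminus_complex.sel
            minus_zero)
      then show False using i ns by auto
    qed
    then have "two_sided_unit ((1 / z) *\<^sub>C 1 - a)" by (simp add: spectrum_iff)
    then have "two_sided_unit (z *\<^sub>C ((1 / z) *\<^sub>C 1 - a))"
      by (simp add: two_sided_unit_scaleC_iff False)
    then show ?thesis using False by (simp add: scaleC_diff_right scaleC_scaleC)
  qed (auto simp: two_sided_unit_def)
  have "continuous_on (cball 0 1) (\<lambda>z. unit_inv (1 - z *\<^sub>C a))"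
    by (rule continuous_on_resolvent) (simp add: u)
  then have "uniformly_continuous_on (cball 0 1) (\<lambda>z. unit_inv (1 - z *\<^sub>C a))"
    by (rule compact_uniformly_continuous) simp
  then obtain d where d: "d > 0" "\<And>z z'. cmod z \<le> 1 \<Longrightarrow> cmod z' \<le> 1 \<Longrightarrow> dist z' z < d \<Longrightarrow>
      dist (unit_inv (1 - z' *\<^sub>C a)) (unit_inv (1 - z *\<^sub>C a)) < 1/10"
    unfolding uniformly_continuous_on_def by (metis divide_pos_pos mem_cball_0 zero_less_numeral zero_less_one)
  define t where "t = max 0 (1 - d / 2)"
  have t: "0 \<le> t" "t < 1" "1 - t < d" using d(1) by (auto simp: t_def)
  have osc: "two_sided_unit (1 - w *\<^sub>C a)
      \<and> two_sided_unit (1 - (complex_of_real t * w) *\<^sub>C a)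
      \<and> norm (unit_inv (1 - w *\<^sub>C a) - unit_inv (1 - (complex_of_real t * w) *\<^sub>C a)) \<le> 1/10"
    if w: "cmod w = 1" for w
  proof -
    have tw: "cmod (complex_of_real t * w) \<le> 1" using w t by (simp add: norm_mult)
    have "w - complex_of_real t * w = complex_of_real (1 - t) * w" by (simp add: algebra_simps)
    then have "dist w (complex_of_real t * w) < d"
      using w t by (simp add: dist_norm norm_mult del: of_real_diff)
    then show ?thesis using d(2)[OF tw, of w] w u tw by (simp add: dist_norm)
  qed
  have "(\<lambda>n. t ^ n) \<longlonglongrightarrow> 0" using t by (intro LIMSEQ_power_zero) simp
  then obtain n0 where n0: "\<And>n. n \<ge> n0 \<Longrightarrow> t ^ n < 1/4"
    using LIMSEQ_D[of "\<lambda>n. t ^ n" 0 "1/4"] t by auto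
  define c where "c = a ^ 2 ^ n0"
  define s where "s = t ^ 2 ^ n0"
  have s: "0 \<le> s" "s \<le> 1/4" using t n0[of "2 ^ n0"] by (auto simp: s_def less_imp_le)
  have nc: "norm c = 1" using norm_selfadjoint_power[OF sa, of n0] n1 by (simp add: c_def)
  note fin = resolvent_oscillation_power[OF osc, of 1 n0, folded c_def s_def, simplified]
  define x where "x = unit_inv (1 - c)"
  define y where "y = unit_inv (1 - complex_of_real s *\<^sub>C c)"
  have xy: "norm (x - y) \<le> 1/10" using fin by (simp add: x_def y_def)
  have x: "x * (1 - c) = 1" using fin by (auto simp: x_def intro: unit_inv)
  have y: "y * (1 - s *\<^sub>R c) = 1"
    using fin unit_inv(1)[of "1 - s *\<^sub>R c"] by (auto simp: y_def scaleC_of_real)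
  have "y - 1 = s *\<^sub>R (y * c)" using y by (simp add: algebra_simps)
  then have "norm (y - 1) \<le> s * norm y"
    using norm_mult_ineq[of y c] nc s by (simp add: mult_left_mono)
  also have "\<dots> \<le> 1/4 * norm y" using s by (intro mult_right_mono) auto
  finally have y1: "norm (y - 1) \<le> 1/4 * norm y" .
  then have "norm y \<le> 4/3" using norm_triangle_ineq2[of y 1] by simp
  then have "norm (y - 1) \<le> 1/3" using y1 by simp
  then have x1: "norm (x - 1) \<le> 1/10 + 1/3"
    using norm_triangle_ineq[of "x - y" "y - 1"] xy by simp
  \<comment> \<open>With \<open>norm (x - 1) \<le> 13/30\<close> and
    \<open>norm (1 - c) \<le> 2\<close> this bounds \<open>norm c\<close> by \<open>13/15\<close>,
    although it equals 1.\<close>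
  have "c = (x - 1) * (1 - c)" using x by (simp add: left_diff_distrib)
  then have "norm c \<le> norm (x - 1) * norm (1 - c)" by (metis norm_mult_ineq)
  also have "\<dots> \<le> (1/10 + 1/3) * 2"
    using x1 norm_triangle_ineq4[of 1 c] nc by (intro mult_mono) auto
  finally show False using nc by simp
qed

text \<open>After rescaling to norm 1, the preceding lemma places \<open>norm a\<close> or
  \<open>- norm a\<close> in the spectrum.\<close>

lemma norm_selfadjoint_le:
  fixes a :: "'a::cstar_algebra"
  assumes sa: "star a = a" and r: "0 \<le> r" "\<And>x. complex_of_real x \<in> spectrum a \<Longrightarrow> \<bar>x\<bar> \<le> r"
  shows "norm a \<le> r"
proof (rule ccontr)
  assume "\<not> ?thesis"
  then have lt: "r < norm a" by simp
  define n where "n = norm a"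
  have n: "n > 0" "r < n" using lt r(1) by (auto simp: n_def simp del: zero_less_norm_iff)
  define b where "b = complex_of_real (1 / n) *\<^sub>C a"
  have ba: "complex_of_real n *\<^sub>C b = a" using n by (simp add: b_def scaleC_scaleC)
  have "star b = b" using sa by (simp add: b_def star_scaleC)
  moreover have "norm b = 1" using n 
    unfolding b_def norm_scaleC norm_of_real n_def[symmetric] by simp
  ultimately have "1 \<in> spectrum b \<or> -1 \<in> spectrum b" by (rule spectral_radius_attained)
  then have "complex_of_real n \<in> spectrum a \<or> complex_of_real (- n) \<in> spectrum a"
    using spectrum_scaleC[of "complex_of_real n" 1 b] spectrum_scaleC[of "complex_of_real n" "-1" b] n
    by (auto simp: ba)
  then show False using r(2) n by fastforce
qed

section \<open>Positive elements\<close>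

lemma positive_selfadjoint: "positive a \<Longrightarrow> star a = a"
  by (simp add: positive_def)

lemma positive_iff_real_spectrum:
  "positive a \<longleftrightarrow> star a = a \<and> (\<forall>x. complex_of_real x \<in> spectrum a \<longrightarrow> 0 \<le> x)"
  (is "?L \<longleftrightarrow> ?R")
proof
  assume L: ?L
  then have "0 \<le> x" if "complex_of_real x \<in> spectrum a" for x
    using that by (auto simp: positive_def complex_nonneg_Reals_iff)
  with L show ?R by (simp add: positive_def)
next
  assume R: ?R
  have "z \<in> \<real>\<^sub>\<ge>\<^sub>0" if z: "z \<in> spectrum a" for z
  proof -
    have i: "Im z = 0" using spectrum_selfadjoint_real[OF _ z] R by simp
    then have "z = complex_of_real (Re z)" by (simp add: complex_eq_iff)
    then show ?thesis using R z i by (metis complex_nonneg_Reals_iff)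
  qed
  with R show ?L by (auto simp: positive_def)
qed

lemma spectrum_real_minus:
  "complex_of_real x \<in> spectrum (r *\<^sub>R 1 - a) \<longleftrightarrow> complex_of_real (r - x) \<in> spectrum a"
  using spectrum_shift[of "complex_of_real (x - r)" "complex_of_real r" "- a"]
    spectrum_minus[of "complex_of_real (r - x)" a]
  by (simp add: scaleC_of_real)

text \<open>Together with its converse \<open>positive_norm_le\<close>, this describes positivity by
  a norm condition, from which closure under sums, nonnegative scaling and limits follows.\<close>

lemma positiveI_norm:
  assumes "star a = a" "norm (r *\<^sub>R 1 - a) \<le> r"
  shows "positive a"
  unfolding positive_iff_real_spectrum
proof (intro conjI allI impI)
  fix x assume "complex_of_real x \<in> spectrum a"
  then have "complex_of_real (r - x) \<in> spectrum (r *\<^sub>R 1 - a)"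
    using spectrum_real_minus[of "r - x" r a] by simp
  from spectrum_norm_le[OF this] have "\<bar>r - x\<bar> \<le> r" using assms(2) by (simp del: of_real_diff)
  then show "0 \<le> x" by simp
qed (rule assms)

lemma positive_norm_le:
  assumes "positive a" "norm a \<le> r"
  shows "norm (r *\<^sub>R 1 - a) \<le> r"
proof (rule norm_selfadjoint_le)
  show "star (r *\<^sub>R 1 - a) = r *\<^sub>R 1 - a"
    using assms(1) by (simp add: star_diff star_scaleR positive_selfadjoint)
  show "0 \<le> r" using assms(2) norm_ge_zero order_trans by blast
  fix x assume "complex_of_real x \<in> spectrum (r *\<^sub>R 1 - a)"
  then have s: "complex_of_real (r - x) \<in> spectrum a" by (simp only: spectrum_real_minus)
  then have "0 \<le> r - x" using assms(1) positive_iff_real_spectrum by blast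
  moreover have "\<bar>r - x\<bar> \<le> r" using spectrum_norm_le[OF s] assms(2) by (simp del: of_real_diff)
  ultimately show "\<bar>x\<bar> \<le> r" by simp
qed

lemma positive_zero [simp]: "positive 0"
  by (rule positiveI_norm[of _ 0]) auto

lemma positive_add:
  assumes "positive a" "positive b"
  shows "positive (a + b)"
proof (rule positiveI_norm)
  show "star (a + b) = a + b" using assms by (simp add: star_add positive_selfadjoint)
  have "(norm a + norm b) *\<^sub>R 1 - (a + b) = (norm a *\<^sub>R 1 - a) + (norm b *\<^sub>R 1 - b)"
    by (simp add: algebra_simps)
  then show "norm ((norm a + norm b) *\<^sub>R 1 - (a + b)) \<le> norm a + norm b"
    using norm_triangle_mono[OF positive_norm_le[OF assms(1) order_refl]
        positive_norm_le[OF assms(2) order_refl]] by (simp only:)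
qed

lemma positive_sum: "(\<And>i. i \<in> S \<Longrightarrow> positive (f i)) \<Longrightarrow> positive (sum f S)"
  by (induction S rule: infinite_finite_induct) (auto simp: positive_add)

lemma positive_scaleR:
  assumes "positive a" "0 \<le> r"
  shows "positive (r *\<^sub>R a)"
proof (rule positiveI_norm)
  show "star (r *\<^sub>R a) = r *\<^sub>R a" using assms by (simp add: star_scaleR positive_selfadjoint)
  have "(r * norm a) *\<^sub>R 1 - r *\<^sub>R a = r *\<^sub>R (norm a *\<^sub>R 1 - a)" by (simp add: algebra_simps)
  then show "norm ((r * norm a) *\<^sub>R 1 - r *\<^sub>R a) \<le> r * norm a"
    using positive_norm_le[OF assms(1) order_refl] assms(2) by (simp add: mult_left_mono)
qed

text \<open>The single radius \<open>norm a + 1\<close> eventually exceeds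
  \<open>norm (f n)\<close>, so the norm criterion for \<open>f n\<close> passes to the
  limit.\<close>

lemma positive_tendsto:
  assumes "f \<longlonglongrightarrow> a" "\<And>n. positive (f n)"
  shows "positive a"
proof (rule positiveI_norm[of _ "norm a + 1"])
  have "(\<lambda>n. star (f n)) \<longlonglongrightarrow> star a" by (rule tendsto_star[OF assms(1)])
  then show "star a = a"
    using assms(1) LIMSEQ_unique by (simp add: positive_selfadjoint[OF assms(2)])
  have ev: "\<forall>\<^sub>F n in sequentially. norm (f n) < norm a + 1"
    by (rule order_tendstoD[OF tendsto_norm[OF assms(1)]]) simp
  have "\<forall>\<^sub>F n in sequentially. norm ((norm a + 1) *\<^sub>R 1 - f n) \<le> norm a + 1"
    using ev by eventually_elim (simp add: positive_norm_le[OF assms(2)])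
  moreover have "(\<lambda>n. norm ((norm a + 1) *\<^sub>R 1 - f n)) \<longlonglongrightarrow> norm ((norm a + 1) *\<^sub>R 1 - a)"
    by (intro tendsto_intros assms)
  ultimately show "norm ((norm a + 1) *\<^sub>R 1 - a) \<le> norm a + 1"
    by (intro tendsto_upperbound) auto
qed

lemma positive_antisym:
  assumes "positive a" "positive (- a)"
  shows "a = 0"
proof -
  have "norm a \<le> 0"
  proof (rule norm_selfadjoint_le)
    fix x assume x: "complex_of_real x \<in> spectrum a"
    then have "complex_of_real (- x) \<in> spectrum (- a)" using spectrum_minus by auto
    then show "\<bar>x\<bar> \<le> 0" using x assms positive_iff_real_spectrum
      by (metis abs_of_nonneg neg_0_le_iff_le)
  qed (use assms in \<open>auto simp: positive_selfadjoint\<close>)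
  then show ?thesis by simp
qed

lemma positive_norm_diff:
  assumes "star a = a" "norm a \<le> r"
  shows "positive (r *\<^sub>R 1 - a)"
  by (rule positiveI_norm[of _ r]) (use assms in \<open>auto simp: star_diff star_scaleR\<close>)

lemma norm_le_positiveI:
  assumes "positive a" "positive (r *\<^sub>R 1 - a)" "0 \<le> r"
  shows "norm a \<le> r"
proof (rule norm_selfadjoint_le)
  fix x assume x: "complex_of_real x \<in> spectrum a"
  then have "complex_of_real (r - x) \<in> spectrum (r *\<^sub>R 1 - a)"
    using spectrum_real_minus[of "r - x" r a] by simp
  then have "0 \<le> r - x" using assms(2) positive_iff_real_spectrum by blast
  moreover have "0 \<le> x" using x assms(1) positive_iff_real_spectrum by blast
  ultimately show "\<bar>x\<bar> \<le> r" by simp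
qed (use assms in \<open>auto simp: positive_selfadjoint\<close>)

lemma norm_mono:
  assumes "positive a" "a \<preceq> b"
  shows "norm a \<le> norm b"
proof (rule norm_le_positiveI)
  have b: "positive b" using positive_add[OF assms(1), of "b - a"] assms(2) by (simp add: cstar_le_def)
  have "positive ((norm b *\<^sub>R 1 - b) + (b - a))"
    using positive_norm_diff[OF positive_selfadjoint[OF b] order_refl] assms(2)
    by (intro positive_add) (simp_all add: cstar_le_def)
  then show "positive (norm b *\<^sub>R 1 - a)" by simp
qed (use assms in auto)

section \<open>Square roots\<close>

text \<open>\<open>sqrt_coeff\<close> are the Taylor coefficients of \<open>t \<mapsto> (1 - t) powr (1/2)\<close> at 0. All but the first
  are negative and every partial sum is nonnegative, so the series converges absolutely on the
  closed unit ball.\<close>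

definition sqrt_coeff :: "nat \<Rightarrow> real" where
  "sqrt_coeff n = pochhammer (- 1/2) n / fact n"

lemma sqrt_coeff_0 [simp]: "sqrt_coeff 0 = 1"
  by (simp add: sqrt_coeff_def)

lemma sqrt_coeff_gbinomial: "sqrt_coeff n = (-1) ^ n * ((1/2) gchoose n)"
  unfolding sqrt_coeff_def gbinomial_pochhammer by simp

lemma sqrt_coeff_Suc_nonpos: "sqrt_coeff (Suc n) \<le> 0"
proof -
  have "0 \<le> pochhammer (1/2::real) n" by (rule pochhammer_nonneg) simp
  then show ?thesis by (simp add: sqrt_coeff_def pochhammer_rec divide_nonpos_pos)
qed

text \<open>Dividing \<open>(1 - t) powr (1/2)\<close> by \<open>1 - t\<close> turns coefficients
  into partial sums, so these are the coefficients of \<open>(1 - t) powr (-1/2)\<close>, all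
  nonnegative.\<close>

lemma sqrt_coeff_sum_nonneg: "0 \<le> (\<Sum>k\<le>n. sqrt_coeff k)"
proof -
  have "(\<Sum>k\<le>n. sqrt_coeff k) = (-1) ^ n * ((-1/2) gchoose n)"
    using gbinomial_sum_lower_neg[of "1/2::real" n]
    by (simp add: sqrt_coeff_gbinomial mult.commute)
  also have "\<dots> = pochhammer (1/2) n / fact n" unfolding gbinomial_pochhammer by simp
  also have "\<dots> \<ge> 0" by (simp add: pochhammer_nonneg)
  finally show ?thesis .
qed

lemma sqrt_coeff_Suc_bound: "(\<Sum>k<n. - sqrt_coeff (Suc k)) \<le> 1"
  using sqrt_coeff_sum_nonneg[of n] by (simp add: sum.atMost_shift sum_negf)

lemma summable_sqrt_coeff: "summable (\<lambda>n. - sqrt_coeff (Suc n))"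
  by (rule summableI_nonneg_bounded[of _ 1]) (use sqrt_coeff_Suc_nonpos sqrt_coeff_Suc_bound in auto)

text \<open>The square of \<open>(1 - t) powr (1/2)\<close> is \<open>1 - t\<close>, read off
  coefficientwise through Vandermonde's identity.\<close>

lemma sqrt_coeff_convolution:
  "(\<Sum>k\<le>n. sqrt_coeff k * sqrt_coeff (n - k)) = (if n = 0 then 1 else if n = 1 then -1 else 0)"
proof -
  have "(\<Sum>k\<le>n. sqrt_coeff k * sqrt_coeff (n - k))
      = (\<Sum>k\<le>n. (-1) ^ n * (((1/2) gchoose k) * ((1/2) gchoose (n - k))))"
  proof (rule sum.cong[OF refl])
    fix k assume "k \<in> {..n}"
    then have "(-1::real) ^ n = (-1) ^ k * (-1) ^ (n - k)" by (simp flip: power_add)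
    then show "sqrt_coeff k * sqrt_coeff (n - k)
        = (-1) ^ n * (((1/2) gchoose k) * ((1/2) gchoose (n - k)))"
      by (simp add: sqrt_coeff_gbinomial)
  qed
  also have "\<dots> = (-1) ^ n * (1 gchoose n)"
    using gbinomial_Vandermonde[of "1/2::real" "1/2" n]
    by (simp add: atMost_atLeast0 flip: sum_distrib_left)
  also have "(1::real) gchoose n = of_nat (1 choose n)"
    using binomial_gbinomial[of 1 n, where 'a = real] by simp
  finally show ?thesis by (cases n) (auto simp: binomial_eq_0 gr0_conv_Suc)
qed

text \<open>The root is the binomial series in \<open>1 - a\<close>. It commutes with whatever
  commutes with \<open>a\<close>, and it is positive because the coefficients after the first sum to
  at most 1 in absolute value, which gives \<open>norm (1 - s) \<le> 1\<close>.\<close>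

lemma sqrt_near_one:
  fixes a :: "'a::cstar_algebra"
  assumes sa: "star a = a" and n1: "norm (1 - a) \<le> 1"
  obtains s where "positive s" "s * s = a" "\<And>x. x * a = a * x \<Longrightarrow> x * s = s * x"
proof
  define x where "x = 1 - a"
  define f where "f n = sqrt_coeff n *\<^sub>R x ^ n" for n
  have nx: "norm (x ^ n) \<le> 1" for n
    using norm_power_ineq[of x n] n1 power_le_one[of "norm x" n] by (simp add: x_def)
  have nf: "norm (f (Suc n)) \<le> - sqrt_coeff (Suc n)" for n
    using nx[of "Suc n"] sqrt_coeff_Suc_nonpos[of n] mult_left_le[of "norm (x ^ Suc n)" "- sqrt_coeff (Suc n)"]
    by (simp add: f_def)
  have sn: "summable (\<lambda>n. norm (f (Suc n)))"
    by (rule summable_comparison_test[OF _ summable_sqrt_coeff]) (use nf in auto)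
  then have sn': "summable (\<lambda>n. norm (f n))" by (subst (asm) summable_Suc_iff)
  have sf: "summable f" by (rule summable_norm_cancel[OF sn'])
  define s where "s = suminf f"
  show "s * s = a"
  proof -
    have "s * s = (\<Sum>n. \<Sum>k\<le>n. f k * f (n - k))"
      unfolding s_def by (rule Cauchy_product[OF sn' sn'])
    also have "(\<lambda>n. \<Sum>k\<le>n. f k * f (n - k))
        = (\<lambda>n. (\<Sum>k\<le>n. sqrt_coeff k * sqrt_coeff (n - k)) *\<^sub>R x ^ n)"
      by (intro ext) (auto simp: f_def scaleR_sum_left intro!: sum.cong simp flip: power_add)
    also have "\<dots> = (\<lambda>n. (if n = 0 then 1 else if n = 1 then - 1 else 0) *\<^sub>R x ^ n)"
      by (simp only: sqrt_coeff_convolution)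
    also have "suminf \<dots> = (\<Sum>n<2. (if n = 0 then 1 else if n = 1 then - 1 else 0) *\<^sub>R x ^ n)"
      by (rule suminf_finite) auto
    also have "\<dots> = a" by (simp add: numeral_2_eq_2 x_def)
    finally show ?thesis .
  qed
  show "y * s = s * y" if "y * a = a * y" for y
  proof -
    have "y * x = x * y" using that by (simp add: x_def algebra_simps)
    then have "y * f n = f n * y" for n
      using power_commuting_commutes[of x y n] by (simp add: f_def)
    then show ?thesis unfolding s_def by (simp add: suminf_mult[OF sf, symmetric] suminf_mult2[OF sf])
  qed
  show "positive s"
  proof (rule positiveI_norm[of _ 1])
    have "star (f n) = f n" for n
      using selfadjoint_power[of x n] sa by (simp add: f_def star_scaleR x_def star_diff)
    then show "star s = s"
      unfolding s_def using bounded_linear.suminf[OF bounded_linear_star sf] by simp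
    have "1 *\<^sub>R 1 - s = - (\<Sum>n. f (Suc n))"
      using suminf_split_head[OF sf] by (simp add: s_def f_def)
    then have "norm (1 *\<^sub>R 1 - s) = norm (\<Sum>n. f (Suc n))" by simp
    also have "\<dots> \<le> (\<Sum>n. - sqrt_coeff (Suc n))"
      by (rule norm_suminf_le[OF nf summable_sqrt_coeff])
    also have "\<dots> \<le> 1"
      by (rule suminf_le_const[OF summable_sqrt_coeff]) (rule sqrt_coeff_Suc_bound)
    finally show "norm (1 *\<^sub>R 1 - s) \<le> 1" .
  qed
qed

lemma positive_sqrt:
  fixes a :: "'a::cstar_algebra"
  assumes "positive a"
  obtains s where "positive s" "s * s = a" "\<And>x. x * a = a * x \<Longrightarrow> x * s = s * x"
proof -
  \<comment> \<open>Dividing by \<open>r\<close> puts \<open>a\<close> within distance 1 of the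
    identity; the summand 1 keeps \<open>r\<close> positive when \<open>a = 0\<close>.\<close>
  define r where "r = norm a + 1"
  have r: "r > 0" by (simp add: r_def add_nonneg_pos)
  define b where "b = (1 / r) *\<^sub>R a"
  have pb: "positive b" using assms r by (simp add: b_def positive_scaleR)
  have "norm b \<le> 1" using r by (simp add: b_def r_def)
  from positive_norm_le[OF pb this] have "norm (1 - b) \<le> 1" by simp
  with positive_selfadjoint[OF pb]
  obtain s where s: "positive s" "s * s = b" "\<And>x. x * b = b * x \<Longrightarrow> x * s = s * x"
    using sqrt_near_one by metis
  show ?thesis
  proof (rule that[of "sqrt r *\<^sub>R s"])
    show "positive (sqrt r *\<^sub>R s)" using s(1) r by (simp add: positive_scaleR)
    show "sqrt r *\<^sub>R s * sqrt r *\<^sub>R s = a" using r by (simp add: s(2)) (simp add: b_def)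
    fix x assume "x * a = a * x"
    then show "x * sqrt r *\<^sub>R s = sqrt r *\<^sub>R s * x" using s(3)[of x] by (simp add: b_def)
  qed
qed

section \<open>Positivity of \<open>a a\<^sup>*\<close>\<close>

text \<open>For negative \<open>x\<close> and \<open>m = i sqrt (- x)\<close>, the element
  \<open>x 1 - b^2\<close> factors as \<open>(m - b) (m + b)\<close>; both factors are invertible
  because \<open>m\<close> and \<open>- m\<close> are not real.\<close>

lemma positive_square:
  fixes b :: "'a::cstar_algebra"
  assumes sa: "star b = b"
  shows "positive (b * b)"
  unfolding positive_iff_real_spectrum
proof (intro conjI allI impI)
  show "star (b * b) = b * b" by (simp add: star_mult sa)
  fix x assume x: "complex_of_real x \<in> spectrum (b * b)"
  show "0 \<le> x"
  proof (rule ccontr)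
    assume "\<not> 0 \<le> x"
    then have neg: "x < 0" by simp
    define m where "m = \<i> * complex_of_real (sqrt (- x))"
    have "m * m = (\<i> * \<i>) * complex_of_real (sqrt (- x) * sqrt (- x))"
      unfolding m_def of_real_mult by (simp only: ac_simps)
    then have mm: "m * m = complex_of_real x" using neg by simp
    have "Im m \<noteq> 0" "Im (- m) \<noteq> 0" using neg by (auto simp: m_def)
    then have "m \<notin> spectrum b" "- m \<notin> spectrum b"
      using spectrum_selfadjoint_real[OF sa] by blast+
    then have "two_sided_unit (m *\<^sub>C 1 - b)" "two_sided_unit ((-1) *\<^sub>C ((- m) *\<^sub>C 1 - b))"
      using two_sided_unit_scaleC_iff[of "-1" "(- m) *\<^sub>C 1 - b"] by (simp_all add: spectrum_iff)
    then have "two_sided_unit ((m *\<^sub>C 1 - b) * ((-1) *\<^sub>C ((- m) *\<^sub>C 1 - b)))"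
      by (rule two_sided_unit_mult)
    also have "(m *\<^sub>C 1 - b) * ((-1) *\<^sub>C ((- m) *\<^sub>C 1 - b)) = complex_of_real x *\<^sub>C 1 - b * b"
      by (simp add: scaleC_minus_left scaleC_mult_left scaleC_mult_right scaleC_scaleC
          scaleC_diff_right scaleC_add_right algebra_simps flip: mm)
    finally show False using x by (simp add: spectrum_iff)
  qed
qed

text \<open>If \<open>w\<close> inverts \<open>z 1 - x y\<close>, then
  \<open>(1 + y w x) / z\<close> inverts \<open>z 1 - y x\<close>.\<close>

lemma spectrum_mult_commute:
  fixes x y :: "'a::cstar_algebra"
  assumes "z \<noteq> 0" "z \<notin> spectrum (x * y)"
  shows "z \<notin> spectrum (y * x)"
proof -
  define w where "w = unit_inv (z *\<^sub>C 1 - x * y)"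
  have u: "two_sided_unit (z *\<^sub>C 1 - x * y)" using assms by (simp add: spectrum_iff)
  have w: "z *\<^sub>C w - w * x * y = 1" "z *\<^sub>C w - x * y * w = 1"
    using unit_inv[OF u] unfolding w_def[symmetric]
    by (simp_all add: algebra_simps scaleC_mult_left scaleC_mult_right)
  define v where "v = 1 + y * w * x"
  have "v * (z *\<^sub>C 1 - y * x) = z *\<^sub>C 1 - y * x + y * (z *\<^sub>C w - w * x * y) * x"
    by (simp add: v_def algebra_simps scaleC_mult_left scaleC_mult_right scaleC_add_right)
  moreover have "(z *\<^sub>C 1 - y * x) * v = z *\<^sub>C 1 - y * x + y * (z *\<^sub>C w - x * y * w) * x"
    by (simp add: v_def algebra_simps scaleC_mult_left scaleC_mult_right scaleC_add_right)
  ultimately have "v * (z *\<^sub>C 1 - y * x) = z *\<^sub>C 1" "(z *\<^sub>C 1 - y * x) * v = z *\<^sub>C 1"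
    unfolding w by simp_all
  then have "two_sided_unit (z *\<^sub>C 1 - y * x)"
    unfolding two_sided_unit_def using assms(1)
    by (intro exI[of _ "(1 / z) *\<^sub>C v"]) (simp add: scaleC_mult_left scaleC_mult_right scaleC_scaleC)
  then show ?thesis by (simp add: spectrum_iff)
qed

lemma positive_minus_mult_commute:
  fixes y :: "'a::cstar_algebra"
  assumes "positive (- (star y * y))"
  shows "positive (- (y * star y))"
  unfolding positive_iff_real_spectrum
proof (intro conjI allI impI)
  show "star (- (y * star y)) = - (y * star y)" by (simp add: star_minus star_mult star_star)
  fix x assume "complex_of_real x \<in> spectrum (- (y * star y))"
  then have x: "complex_of_real (- x) \<in> spectrum (y * star y)"
    using spectrum_minus[of "complex_of_real (- x)" "y * star y"] by simp
  show "0 \<le> x"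
  proof (rule ccontr)
    assume n: "\<not> 0 \<le> x"
    then have "complex_of_real (- x) \<in> spectrum (star y * y)"
      using x spectrum_mult_commute[of "complex_of_real (- x)" "star y" y] by auto
    then have "complex_of_real x \<in> spectrum (- (star y * y))"
      using spectrum_minus[of "complex_of_real (- x)" "star y * y"] by simp
    then show False using assms n by (simp add: positive_iff_real_spectrum)
  qed
qed

text \<open>\<open>h\<close> and \<open>k\<close> are, up to sign, twice the real and imaginary
  parts of \<open>y\<close>, so \<open>h^2 + k^2\<close>, which is twice
  \<open>star y * y + y * star y\<close>, is positive. As \<open>- (y * star y)\<close> is positive
  too, so is \<open>star y * y\<close>, which must then vanish.\<close>

lemma negative_star_mult_zero:
  fixes y :: "'a::cstar_algebra"
  assumes neg: "positive (- (star y * y))"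
  shows "star y * y = 0"
proof -
  define h where "h = y + star y"
  define k where "k = \<i> *\<^sub>C (y - star y)"
  have "positive (h * h + k * k)"
    by (intro positive_add positive_square)
      (simp_all add: h_def k_def star_add star_star star_scaleC star_diff scaleC_minus_left
        scaleC_diff_right add.commute)
  also have "k * k = - ((y - star y) * (y - star y))"
    unfolding k_def scaleC_mult_left scaleC_mult_right scaleC_scaleC by (simp add: scaleC_minus_left)
  also have "h * h + - ((y - star y) * (y - star y)) = 2 *\<^sub>R (star y * y + y * star y)"
    by (simp add: h_def algebra_simps scaleR_2)
  finally have "positive ((1/2) *\<^sub>R (2 *\<^sub>R (star y * y + y * star y)))"
    by (rule positive_scaleR) simp
  then have "positive (star y * y + y * star y)" by simp
  from positive_add[OF this positive_minus_mult_commute[OF neg]]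
  have "positive (star y * y)" by simp
  then show ?thesis using positive_antisym neg by blast
qed

text \<open>With \<open>s = (b\<^sup>2)\<^sup>1\<^sup>/\<^sup>2\<close> in the role of the absolute value of \<open>b = a\<^sup>* a\<close> and \<open>v = s - b\<close> in the
  role of (twice) its negative part, \<open>(a v)\<^sup>* (a v) = - v\<^sup>3 / 2 \<le> 0\<close> forces \<open>v = 0\<close>.\<close>

lemma positive_star_mult: "positive (star a * (a::'a::cstar_algebra))"
proof -
  define b where "b = star a * a"
  have sab: "star b = b" by (simp add: b_def star_mult star_star)
  obtain s where s: "positive s" "s * s = b * b" "\<And>x. x * (b * b) = (b * b) * x \<Longrightarrow> x * s = s * x"
    using positive_sqrt[OF positive_square[OF sab]] by metis
  have bs: "b * s = s * b" by (rule s(3)) (simp add: mult.assoc)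
  obtain q where q: "positive q" "q * q = s" "\<And>x. x * s = s * x \<Longrightarrow> x * q = q * x"
    using positive_sqrt[OF s(1)] by metis
  define v where "v = s - b"
  have sav: "star v = v" using sab positive_selfadjoint[OF s(1)] by (simp add: v_def star_diff)
  have vs: "v * s = s * v" using bs by (simp add: v_def algebra_simps)
  have vq: "v * q = q * v" by (rule q(3)[OF vs])
  have vv: "v * v = 2 *\<^sub>R (s * v)" and vb: "b * v = - (s * v)"
    using bs s(2) by (simp_all add: v_def algebra_simps scaleR_2)
  \<comment> \<open>The root \<open>q\<close> of \<open>s\<close> commutes with \<open>v\<close>, so
    \<open>s v^2\<close> becomes the square of the self-adjoint element \<open>q v\<close>.\<close>
  have v3: "v * v * v = 2 *\<^sub>R ((q * v) * (q * v))"
  proof -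
    have "v * v * v = 2 *\<^sub>R (s * v * v)" by (simp add: vv)
    also have "s * v * v = q * (q * v) * v" by (simp add: mult.assoc flip: q(2))
    also have "\<dots> = q * (v * q) * v" by (simp only: vq)
    also have "\<dots> = (q * v) * (q * v)" by (simp only: mult.assoc)
    finally show ?thesis .
  qed
  have "star (q * v) = q * v" using sav positive_selfadjoint[OF q(1)] vq by (simp add: star_mult)
  then have pv: "positive (v * v * v)" unfolding v3 by (intro positive_scaleR positive_square) auto
  have "star (a * v) * (a * v) = v * (b * v)" by (simp add: star_mult sav b_def mult.assoc)
  also have "\<dots> = - (1/2) *\<^sub>R (v * v * v)" by (simp add: vb mult.assoc) (simp add: vv)
  finally have av: "star (a * v) * (a * v) = - (1/2) *\<^sub>R (v * v * v)" .
  then have "positive (- (star (a * v) * (a * v)))" using positive_scaleR[OF pv, of "1/2"] by simp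
  from negative_star_mult_zero[OF this] av have "v * v * v = 0" by simp
  \<comment> \<open>The exponent is raised to 4, a power of two, where the norm of a self-adjoint
    power is the power of the norm.\<close>
  then have "v ^ 2 ^ 2 = 0" by (simp add: power4_eq_xxxx mult.assoc)
  then have "norm v ^ 2 ^ 2 = 0" using norm_selfadjoint_power[OF sav, of 2] by simp
  then have "v = 0" by simp
  then show ?thesis using s(1) by (simp add: v_def b_def)
qed

lemma positive_mult_star: "positive (a * star (a::'a::cstar_algebra))"
  using positive_star_mult[of "star a"] by (simp add: star_star)

lemma positive_conjugate:
  assumes "positive (c::'a::cstar_algebra)"
  shows "positive (b * c * star b)"
proof -
  obtain s where s: "positive s" "s * s = c" using positive_sqrt[OF assms] by metis
  have "b * c * star b = (b * s) * star (b * s)"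
    using positive_selfadjoint[OF s(1)] by (simp add: star_mult mult.assoc flip: s(2))
  then show ?thesis by (simp add: positive_mult_star)
qed

section \<open>Two norm inequalities\<close>

text \<open>The hypothesis says \<open>\<langle>x - a y, x - a y\<rangle> \<ge> 0\<close> for \<open>p = \<langle>x, x\<rangle>\<close>, \<open>q = \<langle>y, y\<rangle>\<close>, \<open>c = \<langle>x, y\<rangle>\<close>.\<close>

lemma cauchy_schwarz_algebraic:
  fixes p q c :: "'a::cstar_algebra"
  assumes pos: "\<And>a. positive (p - a * star c - c * star a + a * q * star a)" and q: "positive q"
  shows "(norm c)\<^sup>2 \<le> norm p * norm q"
proof -
  define n where "n = norm q"
  have n: "n \<ge> 0" by (simp add: n_def)
  \<comment> \<open>Take \<open>a = t c\<close> and bound \<open>c q (star c)\<close> by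
    \<open>n c (star c)\<close>, which leaves a scalar quadratic in \<open>t\<close>.\<close>
  have *: "positive (p - (2 * t - t\<^sup>2 * n) *\<^sub>R (c * star c))" for t
  proof -
    have "positive (c * (n *\<^sub>R 1 - q) * star c)"
      by (intro positive_conjugate positive_norm_diff)
        (use q in \<open>auto simp: positive_selfadjoint n_def\<close>)
    then have "positive (t\<^sup>2 *\<^sub>R (c * (n *\<^sub>R 1 - q) * star c))" by (rule positive_scaleR) simp
    with pos[of "t *\<^sub>R c"] have "positive ((p - (t *\<^sub>R c) * star c - c * star (t *\<^sub>R c) +
       (t *\<^sub>R c) * q * star (t *\<^sub>R c)) + t\<^sup>2 *\<^sub>R (c * (n *\<^sub>R 1 - q) * star c))"
      by (rule positive_add)
    also have "(p - (t *\<^sub>R c) * star c - c * star (t *\<^sub>R c) +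
       (t *\<^sub>R c) * q * star (t *\<^sub>R c)) + t\<^sup>2 *\<^sub>R (c * (n *\<^sub>R 1 - q) * star c)
       = p - (2 * t - t\<^sup>2 * n) *\<^sub>R (c * star c)"
    proof -
      have d: "(t * 2) *\<^sub>R z = t *\<^sub>R z + t *\<^sub>R z" for z :: 'a
        by (simp only: mult_2_right scaleR_add_left)
      show ?thesis by (simp add: star_scaleR algebra_simps power2_eq_square d)
    qed
    finally show ?thesis .
  qed
  have **: "(2 * t - t\<^sup>2 * n) * (norm c)\<^sup>2 \<le> norm p" if "2 * t - t\<^sup>2 * n \<ge> 0" for t
    using norm_mono[of "(2 * t - t\<^sup>2 * n) *\<^sub>R (c * star c)" p] *[of t] that
    by (simp add: positive_scaleR positive_mult_star cstar_le_def norm_mult_star)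
  show ?thesis
  proof (cases "n = 0")
    case True
    have "c = 0"
    proof (rule ccontr)
      assume c: "c \<noteq> 0"
      then show False using **[of "(norm p + 1) / (2 * (norm c)\<^sup>2)"] True by simp
    qed
    then show ?thesis by simp
  next
    case False
    \<comment> \<open>\<open>t = 1 / n\<close> maximizes \<open>2 * t - t^2 * n\<close>.\<close>
    then show ?thesis using **[of "1 / n"] n by (simp add: power2_eq_square field_simps flip: n_def)
  qed
qed

text \<open>Applied to \<open>p = \<langle>x, x\<rangle>\<close> and \<open>q = \<langle>T x, T x\<rangle>\<close> with \<open>T\<close> bounded and \<open>A\<close>-linear this is Paschke's
  inequality \<open>\<langle>T x, T x\<rangle> \<le> K \<langle>x, x\<rangle>\<close>. Conjugating by \<open>(p + e)\<^sup>-\<^sup>1\<^sup>/\<^sup>2\<close> reduces it to a norm bound.\<close>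

lemma paschke_algebraic:
  fixes p q :: "'a::cstar_algebra"
  assumes p: "positive p" and q: "positive q" and K: "K \<ge> 0"
    and bound: "\<And>a. norm (a * q * star a) \<le> K * norm (a * p * star a)"
  shows "q \<preceq> K *\<^sub>R p"
proof -
  \<comment> \<open>Since \<open>p\<close> need not be invertible, \<open>p + e 1\<close> is used
    and \<open>e\<close> tends to zero at the end.\<close>
  have e: "positive (K *\<^sub>R (p + e *\<^sub>R 1) - q)" if e: "e > 0" for e
  proof -
    let ?r = "p + e *\<^sub>R 1"
    have "positive ?r" using p e by (intro positive_add positive_scaleR) (auto intro: positiveI_norm[of _ 1])
    then obtain g where g: "positive g" "g * g = ?r" using positive_sqrt by metis
    have "complex_of_real (- e) \<notin> spectrum p"
    proof
      assume "complex_of_real (- e) \<in> spectrum p"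
      then have "0 \<le> - e" using p unfolding positive_iff_real_spectrum by blast
      then show False using e by simp
    qed
    then have "two_sided_unit ((-1) *\<^sub>C (complex_of_real (- e) *\<^sub>C 1 - p))"
      by (simp add: spectrum_iff two_sided_unit_scaleC_iff)
    also have "(-1) *\<^sub>C (complex_of_real (- e) *\<^sub>C 1 - p) = ?r"
      by (simp add: scaleC_minus_left scaleC_of_real)
    finally obtain w where w: "w * (g * g) = 1" "g * g * w = 1"
      unfolding two_sided_unit_def g(2) by auto
    \<comment> \<open>\<open>h\<close> is the inverse of \<open>g\<close>, so conjugation by
      \<open>h\<close> carries \<open>p + e 1\<close> to 1 and \<open>p\<close> to an element of
      norm at most 1.\<close>
    define h where "h = w * g"
    have hg: "h * g = 1" using w by (simp add: h_def mult.assoc)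
    have gh: "g * h = 1"
    proof -
      have "g * h = (g * h) * (g * (g * w))" using w by (simp add: mult.assoc)
      also have "\<dots> = g * (h * g) * (g * w)" by (simp only: mult.assoc)
      also have "\<dots> = 1" using hg w by (simp add: mult.assoc)
      finally show ?thesis .
    qed
    have sag: "star g = g" using g(1) by (rule positive_selfadjoint)
    have sah: "star h = h"
    proof -
      have "star h * g = 1" using arg_cong[OF gh, of star] by (simp add: star_mult sag)
      then have "star h * (g * h) = h" by (simp flip: mult.assoc)
      then show ?thesis by (simp add: gh)
    qed
    have "h * p * star h = h * (g * g - e *\<^sub>R 1) * h" by (simp add: g(2) sah)
    also have "\<dots> = (h * g) * (g * h) - e *\<^sub>R (h * h)" by (simp add: algebra_simps)
    finally have hp: "1 *\<^sub>R 1 - h * p * star h = e *\<^sub>R (h * star h)" by (simp add: hg gh sah)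
    have "norm (h * p * star h) \<le> 1"
      by (rule norm_le_positiveI)
        (use p e in \<open>auto simp only: hp intro: positive_conjugate positive_scaleR positive_mult_star\<close>)
    then have "norm (h * q * star h) \<le> K"
      using bound[of h] K by (meson mult_left_le order_trans)
    then have "positive (K *\<^sub>R 1 - h * q * star h)"
      by (intro positive_norm_diff positive_selfadjoint positive_conjugate q)
    then have "positive (g * (K *\<^sub>R 1 - h * q * star h) * star g)" by (rule positive_conjugate)
    also have "g * (K *\<^sub>R 1 - h * q * star h) * star g = K *\<^sub>R (g * g) - (g * h) * q * (h * g)"
      by (simp add: sag sah algebra_simps)
    finally show ?thesis by (simp add: g(2) gh hg)
  qed
  have "(\<lambda>n. K *\<^sub>R (p + inverse (real (Suc n)) *\<^sub>R 1) - q) \<longlonglongrightarrow> K *\<^sub>R (p + 0 *\<^sub>R 1) - q"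
    by (intro tendsto_intros LIMSEQ_inverse_real_of_nat)
  then have "positive (K *\<^sub>R (p + 0 *\<^sub>R 1) - q)" by (rule positive_tendsto) (simp add: e)
  then show ?thesis by (simp add: cstar_le_def)
qed

section \<open>The module \<open>\<ell>\<^sup>2(A)\<close>\<close>

text \<open>Beyond an index \<open>m\<close> covering \<open>F\<close>, the partial sum minus the
  sum over \<open>F\<close> is a finite sum of positive terms, and limits of positive elements are
  positive.\<close>

lemma sum_le_suminf_positive:
  fixes f :: "nat \<Rightarrow> 'a::cstar_algebra"
  assumes "\<And>n. positive (f n)" "summable f" "finite F"
  shows "sum f F \<preceq> suminf f"
proof -
  obtain m where m: "F \<subseteq> {..<m}" using assms(3) finite_nat_bounded by blast
  have "(\<lambda>n. (\<Sum>k<n + m. f k) - sum f F) \<longlonglongrightarrow> suminf f - sum f F"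
    by (intro tendsto_intros LIMSEQ_ignore_initial_segment summable_LIMSEQ assms)
  moreover have "positive ((\<Sum>k<n + m. f k) - sum f F)" for n
  proof -
    have "F \<subseteq> {..<n + m}" using m by auto
    then have "(\<Sum>k<n + m. f k) - sum f F = sum f ({..<n + m} - F)"
      by (simp add: sum_diff)
    then show ?thesis using assms(1) by (simp add: positive_sum)
  qed
  ultimately show ?thesis unfolding cstar_le_def by (rule positive_tendsto)
qed

lemma finite_cauchy_schwarz:
  fixes a b :: "nat \<Rightarrow> 'a::cstar_algebra"
  shows "(norm (\<Sum>n\<in>F. a n * star (b n)))\<^sup>2
    \<le> norm (\<Sum>n\<in>F. a n * star (a n)) * norm (\<Sum>n\<in>F. b n * star (b n))"
proof (rule cauchy_schwarz_algebraic)
  fix x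
  have "positive (\<Sum>n\<in>F. (a n - x * b n) * star (a n - x * b n))"
    by (intro positive_sum positive_mult_star)
  also have "(\<Sum>n\<in>F. (a n - x * b n) * star (a n - x * b n))
      = (\<Sum>n\<in>F. a n * star (a n) - x * star (a n * star (b n)) - a n * star (b n) * star x
          + x * (b n * star (b n)) * star x)"
    by (intro sum.cong refl) (simp add: star_diff star_mult star_star algebra_simps)
  also have "\<dots> = (\<Sum>n\<in>F. a n * star (a n)) - x * star (\<Sum>n\<in>F. a n * star (b n))
      - (\<Sum>n\<in>F. a n * star (b n)) * star x + x * (\<Sum>n\<in>F. b n * star (b n)) * star x"
    by (simp add: sum.distrib sum_subtractf star_sum sum_distrib_left sum_distrib_right)
  finally show "positive \<dots>" .
qed (intro positive_sum positive_mult_star)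

lemma ell2_partial_sum_le:
  assumes "a \<in> ell2" "finite F"
  shows "norm (\<Sum>n\<in>F. a n * star (a n)) \<le> (ell2_norm a)\<^sup>2"
proof -
  have "norm (\<Sum>n\<in>F. a n * star (a n)) \<le> norm (\<Sum>n. a n * star (a n))"
    using assms
    by (intro norm_mono positive_sum positive_mult_star sum_le_suminf_positive) (auto simp: ell2_def)
  then show ?thesis by (simp add: ell2_norm_def ell2_ip_def)
qed

lemma ell2_norm_nonneg [simp]: "0 \<le> ell2_norm a"
  by (simp add: ell2_norm_def)

lemma ell2_norm_sq: "(ell2_norm a)\<^sup>2 = norm (ell2_ip a a)"
  by (simp add: ell2_norm_def)

text \<open>Cauchy criterion: by the finite Cauchy-Schwarz inequality a block is small, as the
  corresponding blocks of \<open>a\<close> tend to zero and those of \<open>b\<close> stay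
  bounded.\<close>

lemma summable_ell2_ip:
  assumes a: "a \<in> ell2" and b: "b \<in> ell2"
  shows "summable (\<lambda>n. a n * star (b n))"
  unfolding summable_Cauchy
proof (intro allI impI)
  fix e :: real assume e: "e > 0"
  let ?B = "(ell2_norm b)\<^sup>2 + 1"
  have B: "?B > 0" by (simp add: add_nonneg_pos)
  have "summable (\<lambda>n. a n * star (a n))" using a by (simp add: ell2_def)
  then obtain N where N: "\<And>m n. m \<ge> N \<Longrightarrow> norm (\<Sum>k\<in>{m..<n}. a k * star (a k)) < e\<^sup>2 / ?B"
    unfolding summable_Cauchy using e B by (meson divide_pos_pos zero_less_power)
  have "norm (\<Sum>k\<in>{m..<n}. a k * star (b k)) < e" if "m \<ge> N" for m n
  proof -
    have "(norm (\<Sum>k\<in>{m..<n}. a k * star (b k)))\<^sup>2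
        \<le> norm (\<Sum>k\<in>{m..<n}. a k * star (a k)) * norm (\<Sum>k\<in>{m..<n}. b k * star (b k))"
      by (rule finite_cauchy_schwarz)
    also have "\<dots> \<le> norm (\<Sum>k\<in>{m..<n}. a k * star (a k)) * ?B"
      using ell2_partial_sum_le[OF b, of "{m..<n}"] by (intro mult_left_mono) auto
    also have "\<dots> < e\<^sup>2" using N[OF that, of n] B by (simp add: pos_less_divide_eq)
    finally show ?thesis using e by (simp add: power2_less_imp_less)
  qed
  then show "\<exists>N. \<forall>m\<ge>N. \<forall>n. norm (\<Sum>k\<in>{m..<n}. a k * star (b k)) < e" by blast
qed

lemma ell2_add:
  assumes "a \<in> ell2" "b \<in> ell2"
  shows "(\<lambda>n. a n + b n) \<in> ell2"
proof -
  have "summable (\<lambda>n. (a n * star (a n) + a n * star (b n)) + (b n * star (a n) + b n * star (b n)))"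
    by (intro summable_add summable_ell2_ip assms)
  then show ?thesis by (simp add: ell2_def star_add algebra_simps)
qed

lemma ell2_mult_left:
  assumes "a \<in> ell2"
  shows "(\<lambda>n. x * a n) \<in> ell2"
proof -
  have "summable (\<lambda>n. x * (a n * star (a n)) * star x)"
    by (intro summable_mult summable_mult2 summable_ell2_ip assms)
  then show ?thesis by (simp add: ell2_def star_mult mult.assoc)
qed

lemma ell2_diff:
  assumes "a \<in> ell2" "b \<in> ell2"
  shows "(\<lambda>n. a n - b n) \<in> ell2"
  using ell2_add[OF assms(1) ell2_mult_left[OF assms(2), of "-1"]] by simp

lemma ell2_ip_add_left:
  assumes "a \<in> ell2" "b \<in> ell2" "c \<in> ell2"
  shows "ell2_ip (\<lambda>n. a n + b n) c = ell2_ip a c + ell2_ip b c"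
  unfolding ell2_ip_def using assms
  by (subst suminf_add) (auto simp: summable_ell2_ip algebra_simps)

lemma ell2_ip_mult_left:
  assumes "a \<in> ell2" "b \<in> ell2"
  shows "ell2_ip (\<lambda>n. x * a n) b = x * ell2_ip a b"
  unfolding ell2_ip_def using assms
  by (subst suminf_mult[symmetric]) (auto simp: summable_ell2_ip mult.assoc)

lemma ell2_ip_diff_left:
  assumes "a \<in> ell2" "b \<in> ell2" "c \<in> ell2"
  shows "ell2_ip (\<lambda>n. a n - b n) c = ell2_ip a c - ell2_ip b c"
  using ell2_ip_add_left[OF assms(1) ell2_mult_left[OF assms(2), of "-1"] assms(3)]
    ell2_ip_mult_left[OF assms(2,3), of "-1"] by simp

lemma ell2_ip_star:
  assumes "a \<in> ell2" "b \<in> ell2"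
  shows "ell2_ip b a = star (ell2_ip a b)"
  unfolding ell2_ip_def
  using bounded_linear.suminf[OF bounded_linear_star summable_ell2_ip[OF assms]]
  by (simp add: star_mult star_star)

lemma ell2_ip_add_right:
  assumes "a \<in> ell2" "b \<in> ell2" "c \<in> ell2"
  shows "ell2_ip c (\<lambda>n. a n + b n) = ell2_ip c a + ell2_ip c b"
  using assms
  by (simp add: ell2_ip_star[of _ c] ell2_add ell2_ip_add_left star_add)

lemma ell2_ip_mult_right:
  assumes "a \<in> ell2" "b \<in> ell2"
  shows "ell2_ip b (\<lambda>n. x * a n) = ell2_ip b a * star x"
  using assms
  by (simp add: ell2_ip_star[of _ b] ell2_mult_left ell2_ip_mult_left star_mult)

lemma ell2_ip_positive: "a \<in> ell2 \<Longrightarrow> positive (ell2_ip a a)"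
  using sum_le_suminf_positive[of "\<lambda>n. a n * star (a n)" "{}"]
  by (simp add: ell2_def ell2_ip_def cstar_le_def positive_mult_star)

lemma ell2_cauchy_schwarz:
  assumes "a \<in> ell2" "b \<in> ell2"
  shows "norm (ell2_ip a b) \<le> ell2_norm a * ell2_norm b"
proof (rule power2_le_imp_le)
  have "(norm (ell2_ip a b))\<^sup>2 \<le> norm (ell2_ip a a) * norm (ell2_ip b b)"
  proof (rule LIMSEQ_le)
    show "(\<lambda>m. (norm (\<Sum>n<m. a n * star (b n)))\<^sup>2) \<longlonglongrightarrow> (norm (ell2_ip a b))\<^sup>2"
      unfolding ell2_ip_def by (intro tendsto_intros summable_LIMSEQ summable_ell2_ip assms)
    show "(\<lambda>m. norm (\<Sum>n<m. a n * star (a n)) * norm (\<Sum>n<m. b n * star (b n)))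
        \<longlonglongrightarrow> norm (ell2_ip a a) * norm (ell2_ip b b)"
      unfolding ell2_ip_def by (intro tendsto_intros summable_LIMSEQ summable_ell2_ip assms)
  qed (use finite_cauchy_schwarz in blast)
  then show "(norm (ell2_ip a b))\<^sup>2 \<le> (ell2_norm a * ell2_norm b)\<^sup>2"
    by (simp add: power_mult_distrib ell2_norm_sq)
qed simp

lemma ell2_norm_triangle:
  assumes "a \<in> ell2" "b \<in> ell2"
  shows "ell2_norm (\<lambda>n. a n + b n) \<le> ell2_norm a + ell2_norm b"
proof (rule power2_le_imp_le)
  have "(ell2_norm (\<lambda>n. a n + b n))\<^sup>2
      = norm ((ell2_ip a a + ell2_ip a b) + (ell2_ip b a + ell2_ip b b))"
    using assms by (simp add: ell2_norm_sq ell2_ip_add_left ell2_ip_add_right ell2_add)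
  also have "\<dots> \<le> ((ell2_norm a)\<^sup>2 + ell2_norm a * ell2_norm b)
      + (ell2_norm b * ell2_norm a + (ell2_norm b)\<^sup>2)"
    using assms by (intro norm_triangle_mono ell2_cauchy_schwarz) (auto simp: ell2_norm_sq)
  finally show "(ell2_norm (\<lambda>n. a n + b n))\<^sup>2 \<le> (ell2_norm a + ell2_norm b)\<^sup>2"
    by (simp add: power2_eq_square algebra_simps)
qed simp

lemma ell2_norm_minus: "ell2_norm (\<lambda>n. - a n) = ell2_norm a"
  by (simp add: ell2_norm_def ell2_ip_def star_minus)

lemma ell2_norm_triangle_diff:
  assumes "a \<in> ell2" "b \<in> ell2"
  shows "ell2_norm (\<lambda>n. a n - b n) \<le> ell2_norm a + ell2_norm b"
  using ell2_norm_triangle[OF assms(1) ell2_mult_left[OF assms(2), of "-1"]]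
  by (simp add: ell2_norm_minus)

lemma ell2_norm_scaleR:
  assumes "a \<in> ell2"
  shows "ell2_norm (\<lambda>n. r *\<^sub>R a n) = \<bar>r\<bar> * ell2_norm a"
proof (rule power2_eq_imp_eq)
  have "ell2_ip (\<lambda>n. (r *\<^sub>R 1) * a n) (\<lambda>n. (r *\<^sub>R 1) * a n) = r\<^sup>2 *\<^sub>R ell2_ip a a"
    using assms
    by (simp only: ell2_ip_mult_left ell2_ip_mult_right ell2_mult_left)
      (simp add: star_scaleR power2_eq_square)
  then show "(ell2_norm (\<lambda>n. r *\<^sub>R a n))\<^sup>2 = (\<bar>r\<bar> * ell2_norm a)\<^sup>2"
    by (simp add: ell2_norm_sq power_mult_distrib)
qed auto

lemma ell2_norm_zero_imp:
  assumes "a \<in> ell2" "ell2_norm a = 0"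
  shows "a = (\<lambda>n. 0)"
proof
  fix n
  have "(norm (a n))\<^sup>2 \<le> 0"
    using ell2_partial_sum_le[OF assms(1), of "{n}"] assms(2) by (simp add: norm_mult_star)
  then show "a n = 0" by simp
qed

lemma ell2_zero: "(\<lambda>n. 0) \<in> ell2"
  by (simp add: ell2_def)

section \<open>Adjointable operators on \<open>\<ell>\<^sup>2(A)\<close>\<close>

text \<open>Nondegeneracy of the inner product; it lets the mere existence of an adjoint imply that
  an operator is \<open>A\<close>-linear.\<close>

lemma ell2_ip_eqI:
  assumes "a \<in> ell2" "b \<in> ell2" "\<And>c. c \<in> ell2 \<Longrightarrow> ell2_ip a c = ell2_ip b c"
  shows "a = b"
proof -
  have d: "(\<lambda>n. a n - b n) \<in> ell2" by (rule ell2_diff[OF assms(1,2)])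
  have "ell2_ip (\<lambda>n. a n - b n) (\<lambda>n. a n - b n) = 0"
    using assms(3)[OF d] ell2_ip_diff_left[OF assms(1,2) d] by simp
  then have "(\<lambda>n. a n - b n) = (\<lambda>n. 0)" by (intro ell2_norm_zero_imp[OF d]) (simp add: ell2_norm_def)
  then show ?thesis by (simp add: fun_eq_iff)
qed

lemma adjointable_in_ell2: "ell2_adjointable U \<Longrightarrow> a \<in> ell2 \<Longrightarrow> U a \<in> ell2"
  by (auto simp: ell2_adjointable_def)

lemma adjointable_add:
  assumes U: "ell2_adjointable U" and a: "a \<in> ell2" and b: "b \<in> ell2"
  shows "U (\<lambda>n. a n + b n) = (\<lambda>n. U a n + U b n)"
proof -
  obtain V where V: "V \<in> ell2 \<rightarrow> ell2"
    "\<And>a b. a \<in> ell2 \<Longrightarrow> b \<in> ell2 \<Longrightarrow> ell2_ip (U a) b = ell2_ip a (V b)"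
    using U by (auto simp: ell2_adjointable_def)
  note m = a b ell2_add[OF a b] adjointable_in_ell2[OF U]
  show ?thesis
  proof (rule ell2_ip_eqI)
    fix c :: "nat \<Rightarrow> 'a" assume c: "c \<in> ell2"
    then have "V c \<in> ell2" using V(1) by auto
    then show "ell2_ip (U (\<lambda>n. a n + b n)) c = ell2_ip (\<lambda>n. U a n + U b n) c"
      using m c by (simp add: V(2) ell2_ip_add_left)
  qed (auto intro: ell2_add m)
qed

lemma adjointable_mult_left:
  assumes U: "ell2_adjointable U" and a: "a \<in> ell2"
  shows "U (\<lambda>n. x * a n) = (\<lambda>n. x * U a n)"
proof -
  obtain V where V: "V \<in> ell2 \<rightarrow> ell2"
    "\<And>a b. a \<in> ell2 \<Longrightarrow> b \<in> ell2 \<Longrightarrow> ell2_ip (U a) b = ell2_ip a (V b)"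
    using U by (auto simp: ell2_adjointable_def)
  note m = a ell2_mult_left[OF a] adjointable_in_ell2[OF U]
  show ?thesis
  proof (rule ell2_ip_eqI)
    fix c :: "nat \<Rightarrow> 'a" assume c: "c \<in> ell2"
    then have "V c \<in> ell2" using V(1) by auto
    then show "ell2_ip (U (\<lambda>n. x * a n)) c = ell2_ip (\<lambda>n. x * U a n) c"
      using m c by (simp add: V(2) ell2_ip_mult_left)
  qed (auto intro: ell2_mult_left m)
qed

lemma adjointable_diff:
  assumes U: "ell2_adjointable U" and a: "a \<in> ell2" and b: "b \<in> ell2"
  shows "U (\<lambda>n. a n - b n) = (\<lambda>n. U a n - U b n)"
  using adjointable_add[OF U a ell2_mult_left[OF b, of "-1"]] adjointable_mult_left[OF U b, of "-1"]
  by simp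

text \<open>The operator norm only sees the unit ball; normalizing \<open>a\<close> and homogeneity
  carry the bound to all of \<open>ell2\<close>, the case of norm zero being separate.\<close>

lemma opnorm_diff_id_bound:
  assumes U: "ell2_adjointable U" and op: "ell2_opnorm (\<lambda>a n. U a n - a n) \<le> ereal u"
    and a: "a \<in> ell2"
  shows "ell2_norm (\<lambda>n. U a n - a n) \<le> u * ell2_norm a"
proof (cases "ell2_norm a = 0")
  case True
  then have "a = (\<lambda>n. 0)" using a by (rule ell2_norm_zero_imp[rotated])
  moreover have "U (\<lambda>n. 0) = (\<lambda>n. 0)" using adjointable_mult_left[OF U ell2_zero, of 0] by simp
  ultimately show ?thesis by (simp add: ell2_norm_def ell2_ip_def)
next
  case False
  define r where "r = ell2_norm a"
  have r: "r > 0" using False by (simp add: r_def order_less_le)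
  define b where "b = (\<lambda>n. (1 / r) *\<^sub>R a n)"
  have b: "b \<in> ell2" using ell2_mult_left[OF a, of "(1 / r) *\<^sub>R 1"] by (simp add: b_def)
  have nb: "ell2_norm b = 1" using ell2_norm_scaleR[OF a, of "1 / r"] r by (simp add: b_def r_def)
  have Ub: "U b = (\<lambda>n. (1 / r) *\<^sub>R U a n)"
    using adjointable_mult_left[OF U a, of "(1 / r) *\<^sub>R 1"] by (simp add: b_def)
  have d: "(\<lambda>n. U a n - a n) \<in> ell2" by (intro ell2_diff a adjointable_in_ell2[OF U])
  have "ereal (ell2_norm (\<lambda>n. U b n - b n)) \<le> ell2_opnorm (\<lambda>a n. U a n - a n)"
    unfolding ell2_opnorm_def by (rule SUP_upper2[of b]) (use b nb in auto)
  from order_trans[OF this op] have "ell2_norm (\<lambda>n. U b n - b n) \<le> u" by simp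
  moreover have "(\<lambda>n. U b n - b n) = (\<lambda>n. (1 / r) *\<^sub>R (U a n - a n))"
    unfolding Ub by (simp add: b_def scaleR_diff_right)
  ultimately have "1 / r * ell2_norm (\<lambda>n. U a n - a n) \<le> u"
    using ell2_norm_scaleR[OF d, of "1 / r"] r by simp
  then have "ell2_norm (\<lambda>n. U a n - a n) \<le> u * r" using r by (simp add: pos_divide_le_eq)
  then show ?thesis by (simp only: r_def)
qed

section \<open>Hilbert modules\<close>

text \<open>\<open>B\<close> may be degenerate: besides the inner product, the lemma serves the form
  of \<open>I - D^-1 S\<close> with \<open>S\<close> the frame operator.\<close>

lemma cauchy_schwarz_form:
  fixes B :: "'e::ab_group_add \<Rightarrow> 'e \<Rightarrow> 'a::cstar_algebra" and act :: "'a \<Rightarrow> 'e \<Rightarrow> 'e"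
  assumes add: "\<And>x y z. B (x + y) z = B x z + B y z"
    and act: "\<And>a x y. B (act a x) y = a * B x y"
    and sym: "\<And>x y. B y x = star (B x y)"
    and pos: "\<And>x. positive (B x x)"
  shows "(norm (B x y))\<^sup>2 \<le> norm (B x x) * norm (B y y)"
proof (rule cauchy_schwarz_algebraic)
  fix a
  have add': "B z (x + y) = B z x + B z y" for x y z
    by (simp add: sym[of z] add star_add)
  have act': "B y (act a x) = B y x * star a" for a x y
    by (simp add: sym[of y] act star_mult)
  have "positive (B (x + act (- a) y) (x + act (- a) y))" by (rule pos)
  also have "B (x + act (- a) y) (x + act (- a) y)
      = B x x - a * star (B x y) - B x y * star a + a * B y y * star a"
    by (simp add: add act add' act' star_minus star_star algebra_simps sym[of x y])
  finally show "positive (B x x - a * star (B x y) - B x y * star a + a * B y y * star a)" .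
qed (rule pos)

text \<open>\<open>K\<close> bounds the analysis operator itself, so it is the square root of the
  usual Bessel constant.\<close>

definition bessel_bound ::
  "('e::banach \<Rightarrow> 'e \<Rightarrow> 'a::cstar_algebra) \<Rightarrow> (nat \<Rightarrow> 'e) \<Rightarrow> real \<Rightarrow> bool" where
  "bessel_bound ip X K \<longleftrightarrow> 0 \<le> K \<and>
     (\<forall>x. analysis ip X x \<in> ell2 \<and> ell2_norm (analysis ip X x) \<le> K * norm x)"

context hilbert_module
begin

lemma norm_sq: "(norm x)\<^sup>2 = norm (ip x x)"
  using norm_ip[of x] by simp

lemma ip_cauchy_schwarz: "norm (ip x y) \<le> norm x * norm y"
proof (rule power2_le_imp_le)
  show "(norm (ip x y))\<^sup>2 \<le> (norm x * norm y)\<^sup>2"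
    unfolding power_mult_distrib norm_sq
    by (rule cauchy_schwarz_form[where act = smul])
      (rule ip_add_left ip_smul_left ip_star ip_positive)+
qed simp

lemma smul_scaleR: "smul (r *\<^sub>R a) x = r *\<^sub>R smul a x"
  using smul_smul[of "r *\<^sub>R 1" a x] by (simp add: smul_of_real)

lemma smul_scaleR_right: "smul a (r *\<^sub>R x) = r *\<^sub>R smul a x"
  using smul_smul[of a "r *\<^sub>R 1" x] by (simp add: smul_of_real smul_scaleR smul_one)

lemma ip_scaleR_left: "ip (r *\<^sub>R x) y = r *\<^sub>R ip x y"
  using ip_smul_left[of "r *\<^sub>R 1" x y] by (simp add: smul_of_real)

lemma ip_smul_right: "ip x (smul a y) = ip x y * star a"
  by (simp add: ip_star[of x] ip_smul_left star_mult)

lemma ip_diff_left: "ip (x - y) z = ip x z - ip y z"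
  using ip_add_left[of x "- y" z] ip_scaleR_left[of "-1" y z] by simp

lemma ip_diff_right: "ip z (x - y) = ip z x - ip z y"
  by (simp add: ip_star[of z] ip_diff_left star_diff)

lemma bounded_linear_ip_left: "bounded_linear (\<lambda>x. ip x y)"
  by (rule bounded_linear_intro[where K = "norm y"])
    (auto simp: ip_add_left ip_scaleR_left ip_cauchy_schwarz)

lemma ip_sum_left: "ip (sum f F) y = (\<Sum>i\<in>F. ip (f i) y)"
  by (rule linear_sum[OF bounded_linear.linear[OF bounded_linear_ip_left]])

lemma bounded_linear_smul: "bounded_linear (smul a)"
proof (rule bounded_linear_intro[where K = "norm a"])
  fix x
  have "(norm (smul a x))\<^sup>2 = norm (a * ip x x * star a)"
    by (simp add: norm_sq ip_smul_left ip_smul_right mult.assoc)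
  also have "\<dots> \<le> norm (a * ip x x) * norm a"
    using norm_mult_ineq[of "a * ip x x" "star a"] by simp
  also have "\<dots> \<le> (norm a * norm (ip x x)) * norm a"
    by (intro mult_right_mono norm_mult_ineq) simp
  also have "\<dots> = (norm x * norm a)\<^sup>2"
    by (simp add: norm_sq[symmetric] power2_eq_square)
  finally show "norm (smul a x) \<le> norm x * norm a" by (rule power2_le_imp_le) simp
qed (auto simp: smul_add_right smul_scaleR_right)

section \<open>Analysis and synthesis operators of Bessel sequences\<close>

lemma analysis_add: "analysis ip X (x + y) = (\<lambda>n. analysis ip X x n + analysis ip X y n)"
  by (simp add: analysis_def ip_add_left)

lemma analysis_smul: "analysis ip X (smul a x) = (\<lambda>n. a * analysis ip X x n)"
  by (simp add: analysis_def ip_smul_left)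

lemma frame_sum_eq: "(\<Sum>n. ip x (X n) * ip (X n) x) = ell2_ip (analysis ip X x) (analysis ip X x)"
  unfolding ell2_ip_def analysis_def by (simp flip: ip_star)

lemma analysis_in_ell2_iff:
  "analysis ip X x \<in> ell2 \<longleftrightarrow> summable (\<lambda>n. ip x (X n) * ip (X n) x)"
  by (simp add: ell2_def analysis_def flip: ip_star)

lemma bessel_boundI:
  assumes "0 \<le> c" "\<And>x. summable (\<lambda>n. ip x (X n) * ip (X n) x)"
    "\<And>x. norm (\<Sum>n. ip x (X n) * ip (X n) x) \<le> c * (norm x)\<^sup>2"
  shows "bessel_bound ip X (sqrt c)"
  unfolding bessel_bound_def
proof (intro conjI allI)
  fix x
  show "analysis ip X x \<in> ell2" by (simp add: analysis_in_ell2_iff assms)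
  show "ell2_norm (analysis ip X x) \<le> sqrt c * norm x"
    by (rule power2_le_imp_le)
      (use assms in \<open>auto simp: ell2_norm_sq power_mult_distrib simp flip: frame_sum_eq\<close>)
qed (use assms in auto)

text \<open>Duality: for the partial sum \<open>w\<close>, Cauchy-Schwarz applied to
  \<open>ip w w\<close>, a pairing of \<open>a\<close> with the analysis of \<open>w\<close>, bounds
  \<open>norm w ^ 4\<close> by a multiple of \<open>norm w ^ 2\<close>, which cancels.\<close>

lemma synthesis_partial_bound:
  assumes X: "bessel_bound ip X K" and F: "finite F"
  shows "(norm (\<Sum>n\<in>F. smul (a n) (X n)))\<^sup>2 \<le> norm (\<Sum>n\<in>F. a n * star (a n)) * K\<^sup>2"
proof -
  define w where "w = (\<Sum>n\<in>F. smul (a n) (X n))"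
  let ?t = "analysis ip X w" and ?A = "norm (\<Sum>n\<in>F. a n * star (a n))"
  have t: "?t \<in> ell2" "ell2_norm ?t \<le> K * norm w" using X by (auto simp: bessel_bound_def)
  have "ip w w = (\<Sum>n\<in>F. a n * star (?t n))"
    by (subst (1) w_def) (simp add: ip_sum_left ip_smul_left analysis_def flip: ip_star)
  then have "((norm w)\<^sup>2)\<^sup>2 \<le> ?A * norm (\<Sum>n\<in>F. ?t n * star (?t n))"
    unfolding norm_sq by (simp add: finite_cauchy_schwarz)
  also have "\<dots> \<le> ?A * (K * norm w)\<^sup>2"
    using ell2_partial_sum_le[OF t(1) F] power_mono[OF t(2), of 2]
    by (intro mult_left_mono) auto
  finally have le: "(norm w)\<^sup>2 * (norm w)\<^sup>2 \<le> (?A * K\<^sup>2) * (norm w)\<^sup>2"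
    by (simp add: power2_eq_square ac_simps)
  then have "(norm w)\<^sup>2 \<le> ?A * K\<^sup>2"
  proof (cases "w = 0")
    case False
    then have "0 < (norm w)\<^sup>2" by simp
    with le show ?thesis by (rule mult_right_le_imp_le)
  qed simp
  then show ?thesis by (simp add: w_def)
qed

lemma summable_synthesis:
  assumes X: "bessel_bound ip X K" and a: "a \<in> ell2"
  shows "summable (\<lambda>n. smul (a n) (X n))"
  unfolding summable_Cauchy
proof (intro allI impI)
  fix e :: real assume e: "e > 0"
  let ?B = "K\<^sup>2 + 1"
  have B: "?B > 0" by (simp add: add_nonneg_pos)
  have "summable (\<lambda>n. a n * star (a n))" using a by (simp add: ell2_def)
  then obtain N where N: "\<And>m n. m \<ge> N \<Longrightarrow> norm (\<Sum>k\<in>{m..<n}. a k * star (a k)) < e\<^sup>2 / ?B"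
    unfolding summable_Cauchy using e B by (meson divide_pos_pos zero_less_power)
  have "norm (\<Sum>k\<in>{m..<n}. smul (a k) (X k)) < e" if "m \<ge> N" for m n
  proof -
    have "(norm (\<Sum>k\<in>{m..<n}. smul (a k) (X k)))\<^sup>2 \<le> norm (\<Sum>k\<in>{m..<n}. a k * star (a k)) * K\<^sup>2"
      by (rule synthesis_partial_bound[OF X]) simp
    also have "\<dots> \<le> norm (\<Sum>k\<in>{m..<n}. a k * star (a k)) * ?B"
      by (intro mult_left_mono) auto
    also have "\<dots> < e\<^sup>2" using N[OF that, of n] B by (simp add: pos_less_divide_eq)
    finally show ?thesis using e by (simp add: power2_less_imp_less)
  qed
  then show "\<exists>N. \<forall>m\<ge>N. \<forall>n. norm (\<Sum>k\<in>{m..<n}. smul (a k) (X k)) < e" by blast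
qed

text \<open>Adjointness of synthesis and analysis; the inner product is continuous in its first
  argument, so it passes through the series.\<close>

lemma ip_synthesis:
  assumes X: "bessel_bound ip X K" and a: "a \<in> ell2"
  shows "ip (synthesis smul X a) y = ell2_ip a (analysis ip X y)"
  unfolding synthesis_def ell2_ip_def analysis_def
    bounded_linear.suminf[OF bounded_linear_ip_left summable_synthesis[OF X a]]
  by (simp add: ip_smul_left flip: ip_star)

lemma norm_synthesis_le:
  assumes X: "bessel_bound ip X K" and a: "a \<in> ell2"
  shows "norm (synthesis smul X a) \<le> K * ell2_norm a"
proof -
  let ?w = "synthesis smul X a"
  have t: "analysis ip X ?w \<in> ell2" "ell2_norm (analysis ip X ?w) \<le> K * norm ?w"
    using X by (auto simp: bessel_bound_def)
  have "(norm ?w)\<^sup>2 \<le> ell2_norm a * ell2_norm (analysis ip X ?w)"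
    unfolding norm_sq ip_synthesis[OF X a] by (rule ell2_cauchy_schwarz[OF a t(1)])
  also have "\<dots> \<le> ell2_norm a * (K * norm ?w)" by (intro mult_left_mono t) simp
  finally have "norm ?w * norm ?w \<le> (K * ell2_norm a) * norm ?w"
    by (simp add: power2_eq_square ac_simps)
  then show ?thesis
    using X by (cases "?w = 0") (auto simp: bessel_bound_def)
qed

lemma synthesis_add:
  assumes X: "bessel_bound ip X K" and "a \<in> ell2" "b \<in> ell2"
  shows "synthesis smul X (\<lambda>n. a n + b n) = synthesis smul X a + synthesis smul X b"
  unfolding synthesis_def smul_add_left
  by (rule suminf_add[symmetric]) (intro summable_synthesis[OF X] assms)+

lemma synthesis_mult_left:
  assumes X: "bessel_bound ip X K" and "a \<in> ell2"
  shows "synthesis smul X (\<lambda>n. x * a n) = smul x (synthesis smul X a)"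
  unfolding synthesis_def smul_smul[symmetric]
  by (rule bounded_linear.suminf[OF bounded_linear_smul, symmetric])
    (intro summable_synthesis[OF X] assms)

lemma synthesis_diff:
  assumes X: "bessel_bound ip X K" and a: "a \<in> ell2" and b: "b \<in> ell2"
  shows "synthesis smul X (\<lambda>n. a n - b n) = synthesis smul X a - synthesis smul X b"
  using synthesis_add[OF X a ell2_mult_left[OF b, of "-1"]] synthesis_mult_left[OF X b, of "-1"]
    smul_of_real[of "-1"] by simp

end

section \<open>Frames and multipliers\<close>

text \<open>Solving \<open>M x = y\<close> amounts to finding a fixed point of the map sending
  \<open>x\<close> to \<open>y / D + (x - M x / D)\<close>, which is a contraction; the lower bound
  is the triangle inequality.\<close>

lemma near_scalar_invertible:
  fixes M :: "'e::banach \<Rightarrow> 'e"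
  assumes M: "linear M" and D: "0 < D" and k: "k < 1"
    and near: "\<And>x. norm (x - (1 / D) *\<^sub>R M x) \<le> k * norm x"
  shows "invertible_operator M" and "norm x \<le> 1 / (D * (1 - k)) * norm (M x)"
proof -
  interpret linear M by (rule M)
  define N where "N x = x - (1 / D) *\<^sub>R M x" for x
  \<comment> \<open>The fixed point theorem wants a nonnegative factor, while \<open>k\<close> is
    only known to be below 1.\<close>
  define c where "c = max k 0"
  have c: "0 \<le> c" "c < 1" using k by (auto simp: c_def)
  have Nc: "norm (N x) \<le> c * norm x" for x
    using near[of x] mult_right_mono[of k c "norm x"] by (auto simp: N_def c_def)
  have ex1: "\<exists>!x. M x = y" for y
  proof -
    define f where "f x = (1 / D) *\<^sub>R y + N x" for x
    have "dist (f x) (f x') \<le> c * dist x x'" for x x'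
    proof -
      have "f x - f x' = N (x - x')" by (simp add: f_def N_def diff algebra_simps)
      then show ?thesis using Nc[of "x - x'"] by (simp add: dist_norm)
    qed
    then have "\<exists>!x. f x = x" using banach_fix_type[OF c] by blast
    moreover have "f x = x \<longleftrightarrow> M x = y" for x
      using D by (auto simp: f_def N_def)
    ultimately show ?thesis by simp
  qed
  have lower: "norm x \<le> 1 / (D * (1 - k)) * norm (M x)" for x
  proof -
    have "norm x \<le> norm (x - (1 / D) *\<^sub>R M x) + norm ((1 / D) *\<^sub>R M x)"
      by (metis add.commute norm_triangle_sub)
    then have "(1 - k) * norm x \<le> norm (M x) / D" using near[of x] D by (simp add: algebra_simps)
    then show ?thesis using D k by (simp add: field_simps)
  qed
  then show "norm x \<le> 1 / (D * (1 - k)) * norm (M x)" .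
  have bij: "bij M" using ex1 by (simp add: bij_iff)
  then have MI: "M (inv M y) = y" for y by (simp add: bij_is_surj surj_f_inv_f)
  have IM: "inv M y = x" if "M x = y" for x y using that bij by (auto simp: bij_is_inj)
  have "bounded_linear (inv M)"
  proof (rule bounded_linear_intro[where K = "1 / (D * (1 - k))"])
    show "inv M (x + y) = inv M x + inv M y" for x y by (rule IM) (simp add: add MI)
    show "inv M (r *\<^sub>R x) = r *\<^sub>R inv M x" for r x by (rule IM) (simp add: scale MI)
    show "norm (inv M x) \<le> norm x * (1 / (D * (1 - k)))" for x
      using lower[of "inv M x"] by (simp add: MI)
  qed
  then show "invertible_operator M" using bij by (simp add: invertible_operator_def)
qed

text \<open>With \<open>z\<close> for the fraction, the hypothesis gives
  \<open>sqrt (D * lam) < z\<close>, and \<open>(1 + C^2 / D^2) * z = C - C^2 / D\<close>. The other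
  summand contributes exactly \<open>C^2 / D\<close>.\<close>

lemma multiplier_constant_bound:
  fixes C D lam :: real
  assumes "0 < C" "C \<le> D"
    and lam: "lam < 1 / D * ((C * D\<^sup>2 - C\<^sup>2 * D) / (C\<^sup>2 + D\<^sup>2))\<^sup>2"
  shows "sqrt D * (C\<^sup>2 / D\<^sup>2 * sqrt D + (1 + C\<^sup>2 / D\<^sup>2) * sqrt lam) < C"
proof -
  define z where "z = (C * D\<^sup>2 - C\<^sup>2 * D) / (C\<^sup>2 + D\<^sup>2)"
  have D: "0 < D" using assms by simp
  have CD: "C * D\<^sup>2 - C\<^sup>2 * D = C * D * (D - C)" by (simp add: power2_eq_square algebra_simps)
  have z: "0 \<le> z" unfolding z_def CD using assms D by simp
  have "lam < 1 / D * z\<^sup>2" using lam by (simp only: z_def)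
  then have "D * lam < z\<^sup>2" using D by (simp add: pos_less_divide_eq mult.commute)
  then have "sqrt (D * lam) < z" using z by (metis real_sqrt_abs real_sqrt_less_iff abs_of_nonneg)
  then have "(1 + C\<^sup>2 / D\<^sup>2) * (sqrt D * sqrt lam) < (1 + C\<^sup>2 / D\<^sup>2) * z"
    by (intro mult_strict_left_mono) (auto simp: real_sqrt_mult intro: add_pos_nonneg)
  also have "(1 + C\<^sup>2 / D\<^sup>2) * z = C - C\<^sup>2 / D"
  proof -
    have "1 + C\<^sup>2 / D\<^sup>2 = (C\<^sup>2 + D\<^sup>2) / D\<^sup>2" using D by (simp add: field_simps)
    moreover have "C\<^sup>2 + D\<^sup>2 \<noteq> 0" using D by (simp add: sum_power2_eq_zero_iff)
    ultimately have e: "(1 + C\<^sup>2 / D\<^sup>2) * z = (C * D * (D - C)) / D\<^sup>2"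
      unfolding z_def CD by simp
    show ?thesis unfolding e using D by (simp add: power2_eq_square field_simps)
  qed
  finally have e1: "(1 + C\<^sup>2 / D\<^sup>2) * (sqrt D * sqrt lam) < C - C\<^sup>2 / D" .
  have e2: "C\<^sup>2 / D\<^sup>2 * (sqrt D * sqrt D) = C\<^sup>2 / D" using D by (simp add: power2_eq_square)
  have e3: "sqrt D * (q * sqrt D + (1 + q) * s) = q * (sqrt D * sqrt D) + (1 + q) * (sqrt D * s)"
    for q s by (simp only: algebra_simps)
  show ?thesis unfolding e3 e2 using e1 by simp
qed

context hilbert_module
begin

lemma frame_bessel_bound:
  assumes "frame_inequalities ip X C D"
  shows "bessel_bound ip X (sqrt D)"
proof (rule bessel_boundI)
  fix x
  have s: "summable (\<lambda>n. ip x (X n) * ip (X n) x)"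
    and le: "(\<Sum>n. ip x (X n) * ip (X n) x) \<preceq> D *\<^sub>R ip x x"
    using assms by (auto simp: frame_inequalities_def)
  show "summable (\<lambda>n. ip x (X n) * ip (X n) x)" by (rule s)
  have "positive (\<Sum>n. ip x (X n) * ip (X n) x)"
    unfolding frame_sum_eq using s by (intro ell2_ip_positive) (simp add: analysis_in_ell2_iff)
  then have "norm (\<Sum>n. ip x (X n) * ip (X n) x) \<le> norm (D *\<^sub>R ip x x)" by (rule norm_mono[OF _ le])
  then show "norm (\<Sum>n. ip x (X n) * ip (X n) x) \<le> D * (norm x)\<^sup>2"
    using assms by (simp add: norm_sq frame_inequalities_def)
qed (use assms in \<open>simp add: frame_inequalities_def\<close>)

text \<open>On the zero module there are no optimal constants, as every pair satisfies the inequalities.\<close>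

lemma frame_bounds_le:
  assumes "frame_bounds ip X C D"
  shows "C \<le> D"
proof (rule ccontr)
  assume "\<not> C \<le> D"
  then have lt: "D < C" by simp
  have f: "frame_inequalities ip X C D" using assms by (simp add: frame_bounds_def)
  have zero: "x = 0" for x :: 'e
  proof -
    have "positive ((\<Sum>n. ip x (X n) * ip (X n) x) - C *\<^sub>R ip x x)"
      "positive (D *\<^sub>R ip x x - (\<Sum>n. ip x (X n) * ip (X n) x))"
      using f by (auto simp: frame_inequalities_def cstar_le_def)
    from positive_add[OF this] have "positive ((D - C) *\<^sub>R ip x x)" by (simp add: algebra_simps)
    then have "positive ((1 / (C - D)) *\<^sub>R ((D - C) *\<^sub>R ip x x))"
      by (rule positive_scaleR) (use lt in simp)
    moreover have "1 / (C - D) * (D - C) = -1" using lt by (simp add: field_simps)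
    ultimately have "positive (- ip x x)" by simp
    then have "ip x x = 0" by (rule positive_antisym[OF ip_positive])
    then show ?thesis by (rule ip_definite)
  qed
  have "ip 0 y = 0" for y using ip_scaleR_left[of 0 0 y] by simp
  then have "ip x y = 0" for x y using zero[of x] by simp
  \<comment> \<open>All inner products vanish, so the lower constant can be raised, against the
    maximality of \<open>C\<close>.\<close>
  then have "frame_inequalities ip X (C + 1) D"
    using f by (simp add: frame_inequalities_def cstar_le_def)
  then have "C + 1 \<le> C" using assms unfolding frame_bounds_def by blast
  then show False by simp
qed

text \<open>Cauchy--Schwarz for the form \<open>\<langle>(I - D\<^sup>-\<^sup>1 S) x, y\<rangle>\<close>, where \<open>S\<close> is the frame operator.\<close>

lemma frame_operator_near_scalar:
  assumes f: "frame_inequalities ip X C D" and CD: "C \<le> D"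
  shows "norm (x - (1 / D) *\<^sub>R synthesis smul X (analysis ip X x)) \<le> (1 - C / D) * norm x"
proof -
  note X = frame_bessel_bound[OF f]
  have D: "D > 0" using f by (simp add: frame_inequalities_def)
  have t: "analysis ip X x \<in> ell2" for x using X by (simp add: bessel_bound_def)
  define B where "B x y = ip x y - (1 / D) *\<^sub>R ell2_ip (analysis ip X x) (analysis ip X y)" for x y
  define k where "k = 1 - C / D"
  have k: "0 \<le> k" using D CD by (simp add: k_def)
  have S: "C *\<^sub>R ip y y \<preceq> ell2_ip (analysis ip X y) (analysis ip X y)"
    "ell2_ip (analysis ip X y) (analysis ip X y) \<preceq> D *\<^sub>R ip y y" for y
    using f by (auto simp: frame_inequalities_def frame_sum_eq)
  \<comment> \<open>Divided by \<open>D\<close>, the two frame inequalities say that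
    \<open>B y y\<close> lies between 0 and \<open>k ip y y\<close>.\<close>
  have pos: "positive (B y y)" for y
    using positive_scaleR[OF S(2)[of y, unfolded cstar_le_def], of "1 / D"] D
    by (simp add: B_def scaleR_diff_right)
  have "B y y \<preceq> k *\<^sub>R ip y y" for y
    using positive_scaleR[OF S(1)[of y, unfolded cstar_le_def], of "1 / D"] D
    by (simp add: B_def cstar_le_def k_def algebra_simps)
  from norm_mono[OF pos this] have nB: "norm (B y y) \<le> k * (norm y)\<^sup>2" for y
    using k by (simp add: norm_sq)
  define P where "P = x - (1 / D) *\<^sub>R synthesis smul X (analysis ip X x)"
  \<comment> \<open>Pairing \<open>P\<close> with itself gives a value of the form, so
    Cauchy-Schwarz bounds \<open>norm P ^ 4\<close> by
    \<open>k^2 norm x ^ 2 norm P ^ 2\<close>.\<close>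
  have "ip P P = B x P"
    unfolding B_def by (subst (1) P_def) (simp add: ip_diff_left ip_scaleR_left ip_synthesis[OF X t])
  then have "((norm P)\<^sup>2)\<^sup>2 = (norm (B x P))\<^sup>2" by (simp add: norm_sq)
  also have "\<dots> \<le> norm (B x x) * norm (B P P)"
  proof (rule cauchy_schwarz_form[where act = smul])
    show "B y x = star (B x y)" for x y
      unfolding B_def ip_star[of y x] ell2_ip_star[OF t t, of y x] by (simp add: star_diff star_scaleR)
  qed (simp_all add: pos, simp_all add: B_def ip_add_left ip_smul_left analysis_add analysis_smul
      ell2_ip_add_left ell2_ip_mult_left t algebra_simps)
  also have "\<dots> \<le> (k * (norm x)\<^sup>2) * (k * (norm P)\<^sup>2)"
    using k by (intro mult_mono nB) auto
  finally have le: "(norm P)\<^sup>2 * (norm P)\<^sup>2 \<le> (k * norm x)\<^sup>2 * (norm P)\<^sup>2"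
    by (simp add: power2_eq_square ac_simps)
  have "norm P \<le> k * norm x"
  proof (cases "P = 0")
    case False
    then have "0 < (norm P)\<^sup>2" by simp
    with le have "(norm P)\<^sup>2 \<le> (k * norm x)\<^sup>2" by (rule mult_right_le_imp_le)
    then show ?thesis by (rule power2_le_imp_le) (use k in simp)
  qed (use k in simp)
  then show ?thesis by (simp add: P_def k_def)
qed

text \<open>Paschke's inequality is used twice, with the roles of \<open>ip x x\<close> and the
  frame sum exchanged, to turn the two norm bounds into the frame inequalities.\<close>

lemma standard_frame_if_bounded_below:
  assumes Y: "bessel_bound ip Y K" and lower: "\<And>x. norm x \<le> c * ell2_norm (analysis ip Y x)"
  shows "standard_frame ip Y"
proof -
  \<comment> \<open>The summand 1 keeps both constants positive; the lower frame constant obtained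
    is \<open>1 / (c^2 + 1)\<close>.\<close>
  let ?C = "c\<^sup>2 + 1" and ?D = "K\<^sup>2 + 1"
  have pos: "0 < ?C" "0 < ?D" by (simp_all add: add_nonneg_pos)
  have t: "analysis ip Y x \<in> ell2" "ell2_norm (analysis ip Y x) \<le> K * norm x" for x
    using Y by (auto simp: bessel_bound_def)
  \<comment> \<open>By \<open>A\<close>-linearity, conjugating by \<open>a\<close> means replacing
    \<open>x\<close> by \<open>smul a x\<close>.\<close>
  have conj: "norm (a * ip x x * star a) = (norm (smul a x))\<^sup>2"
    "norm (a * ell2_ip (analysis ip Y x) (analysis ip Y x) * star a)
      = (ell2_norm (analysis ip Y (smul a x)))\<^sup>2" for a x
    by (simp_all add: norm_sq ip_smul_left ip_smul_right ell2_norm_sq analysis_smul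
        ell2_ip_mult_left ell2_ip_mult_right ell2_mult_left t mult.assoc)
  have up: "ell2_ip (analysis ip Y x) (analysis ip Y x) \<preceq> ?D *\<^sub>R ip x x" for x
  proof (rule paschke_algebraic)
    fix a
    have "(ell2_norm (analysis ip Y (smul a x)))\<^sup>2 \<le> (K * norm (smul a x))\<^sup>2"
      by (intro power_mono t) simp
    then show "norm (a * ell2_ip (analysis ip Y x) (analysis ip Y x) * star a)
        \<le> ?D * norm (a * ip x x * star a)"
      unfolding conj by (simp add: power_mult_distrib distrib_right add_increasing2)
  qed (use t pos in \<open>auto intro: ip_positive ell2_ip_positive\<close>)
  have "ip x x \<preceq> ?C *\<^sub>R ell2_ip (analysis ip Y x) (analysis ip Y x)" for x
  proof (rule paschke_algebraic)
    fix a
    have "(norm (smul a x))\<^sup>2 \<le> (c * ell2_norm (analysis ip Y (smul a x)))\<^sup>2"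
      by (intro power_mono lower) simp
    then show "norm (a * ip x x * star a)
        \<le> ?C * norm (a * ell2_ip (analysis ip Y x) (analysis ip Y x) * star a)"
      unfolding conj by (simp add: power_mult_distrib distrib_right add_increasing2)
  qed (use t pos in \<open>auto intro: ip_positive ell2_ip_positive\<close>)
  then have low: "(1 / ?C) *\<^sub>R ip x x \<preceq> ell2_ip (analysis ip Y x) (analysis ip Y x)" for x
    using positive_scaleR[of "?C *\<^sub>R ell2_ip (analysis ip Y x) (analysis ip Y x) - ip x x" "1 / ?C"] pos(1)
    by (simp add: cstar_le_def scaleR_diff_right)
  have "frame_inequalities ip Y (1 / ?C) ?D"
    unfolding frame_inequalities_def frame_sum_eq analysis_in_ell2_iff[symmetric]
    using up low t pos by simp
  then show ?thesis by (auto simp: standard_frame_def)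
qed

lemma linear_multiplier:
  assumes X: "bessel_bound ip X K" and Y: "bessel_bound ip Y L" and U: "ell2_adjointable U"
  shows "linear (multiplier smul ip U X Y)"
proof
  have t: "analysis ip Y x \<in> ell2" for x using Y by (simp add: bessel_bound_def)
  note s = t adjointable_in_ell2[OF U t]
  show "multiplier smul ip U X Y (x + y) = multiplier smul ip U X Y x + multiplier smul ip U X Y y" for x y
    by (simp add: multiplier_def analysis_add adjointable_add[OF U] synthesis_add[OF X] s)
  have "multiplier smul ip U X Y (smul a x) = smul a (multiplier smul ip U X Y x)" for a x
    by (simp add: multiplier_def analysis_smul adjointable_mult_left[OF U] synthesis_mult_left[OF X] s)
  from this[of "r *\<^sub>R 1" for r]
  show "multiplier smul ip U X Y (r *\<^sub>R x) = r *\<^sub>R multiplier smul ip U X Y x" for r x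
    by (simp add: smul_of_real)
qed

end

theorem proposition3p6:
  fixes smul :: "'a::cstar_algebra \<Rightarrow> 'e::banach \<Rightarrow> 'e"
    and ip :: "'e \<Rightarrow> 'e \<Rightarrow> 'a"
    and X Y :: "nat \<Rightarrow> 'e"
    and U :: "(nat \<Rightarrow> 'a) \<Rightarrow> (nat \<Rightarrow> 'a)"
    and C D lam :: real
  assumes "hilbert_module smul ip"
    and "finitely_generated smul \<or> countably_generated smul"
    and "standard_frame ip X"
    and "frame_bounds ip X C D"
    and "0 < lam"
    and "lam < 1 / D * ((C * D\<^sup>2 - C\<^sup>2 * D) / (C\<^sup>2 + D\<^sup>2))\<^sup>2"
    and "\<forall>x. summable (\<lambda>n. ip x (X n - Y n) * ip (X n - Y n) x) \<and>
             norm (\<Sum>n. ip x (X n - Y n) * ip (X n - Y n) x) \<le> lam * (norm x)\<^sup>2"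
    and "ell2_adjointable U"
    and "\<exists>a\<in>ell2. U a \<noteq> (\<lambda>n. 0)"
    and "ell2_opnorm (\<lambda>a n. U a n - a n) < ereal (C\<^sup>2 / D\<^sup>2)"
  shows "standard_frame ip Y \<and> invertible_operator (multiplier smul ip U X Y)"
proof -
  interpret hilbert_module smul ip by (rule assms(1))
  define u where "u = C\<^sup>2 / D\<^sup>2"
  have u: "0 \<le> u" by (simp add: u_def)
  have f: "frame_inequalities ip X C D" using assms(4) by (simp add: frame_bounds_def)
  then have D: "0 < D" and C: "0 < C" by (auto simp: frame_inequalities_def)
  have CD: "C \<le> D" by (rule frame_bounds_le[OF assms(4)])
  note U = assms(8)
  note X = frame_bessel_bound[OF f]
  have Z: "bessel_bound ip (\<lambda>n. X n - Y n) (sqrt lam)"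
    by (rule bessel_boundI) (use assms(5,7) in auto)
  define S T W where "S = analysis ip X" and "T = analysis ip Y"
    and "W = analysis ip (\<lambda>n. X n - Y n)"
  have S: "S x \<in> ell2" "ell2_norm (S x) \<le> sqrt D * norm x"
    and W: "W x \<in> ell2" "ell2_norm (W x) \<le> sqrt lam * norm x" for x
    using X Z by (auto simp: bessel_bound_def S_def W_def)
  have T_eq: "T x = (\<lambda>n. S x n - W x n)" for x
    by (simp add: S_def T_def W_def analysis_def ip_diff_right)
  have Y: "bessel_bound ip Y (sqrt D + sqrt lam)"
    unfolding bessel_bound_def T_def[symmetric]
  proof (intro conjI allI)
    fix x
    show "T x \<in> ell2" unfolding T_eq by (intro ell2_diff S W)
    have "ell2_norm (T x) \<le> ell2_norm (S x) + ell2_norm (W x)"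
      unfolding T_eq by (intro ell2_norm_triangle_diff S W)
    then show "ell2_norm (T x) \<le> (sqrt D + sqrt lam) * norm x"
      using S(2)[of x] W(2)[of x] by (simp add: distrib_right)
  qed (use D assms(5) in simp)
  then have T: "T x \<in> ell2" for x by (simp add: bessel_bound_def T_def)
  have op: "ell2_norm (\<lambda>n. U a n - a n) \<le> u * ell2_norm a" if "a \<in> ell2" for a
    using opnorm_diff_id_bound[OF U less_imp_le[OF assms(10)] that] by (simp only: u_def)
  have U_bound: "ell2_norm (U a) \<le> (1 + u) * ell2_norm a" if a: "a \<in> ell2" for a
    using ell2_norm_triangle[OF ell2_diff[OF adjointable_in_ell2[OF U a] a] a] op[OF a]
    by (simp add: algebra_simps)
  define M where "M = multiplier smul ip U X Y"
  have M_eq: "M x = synthesis smul X (U (T x))" for x by (simp add: M_def multiplier_def T_def)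
  \<comment> \<open>\<open>sqrt D\<close> bounds the synthesis operator, \<open>u * sqrt D\<close>
    the part \<open>(U - I) S\<close> and \<open>(1 + u) * sqrt lam\<close> the part
    \<open>U W\<close>.\<close>
  define d where "d = sqrt D * (u * sqrt D + (1 + u) * sqrt lam)"
  have SM: "norm (synthesis smul X (S x) - M x) \<le> d * norm x" for x
  proof -
    note s = S[of x] W[of x] adjointable_in_ell2[OF U]
    \<comment> \<open>From \<open>T = S - W\<close>: the deviation splits into \<open>U W\<close>
      and \<open>(U - I) S\<close>.\<close>
    have e: "(\<lambda>n. S x n - U (T x) n) = (\<lambda>n. U (W x) n - (U (S x) n - S x n))"
      unfolding T_eq adjointable_diff[OF U S(1) W(1)] by (simp add: algebra_simps)
    have "ell2_norm (\<lambda>n. S x n - U (T x) n)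
        \<le> ell2_norm (U (W x)) + ell2_norm (\<lambda>n. U (S x) n - S x n)"
      unfolding e by (intro ell2_norm_triangle_diff ell2_diff s)
    also have "\<dots> \<le> (1 + u) * ell2_norm (W x) + u * ell2_norm (S x)"
      by (intro add_mono U_bound op s)
    also have "\<dots> \<le> (1 + u) * (sqrt lam * norm x) + u * (sqrt D * norm x)"
      by (intro add_mono mult_left_mono s) (use u in auto)
    finally have n: "ell2_norm (\<lambda>n. S x n - U (T x) n) \<le> (u * sqrt D + (1 + u) * sqrt lam) * norm x"
      by (simp add: algebra_simps)
    have "synthesis smul X (S x) - M x = synthesis smul X (\<lambda>n. S x n - U (T x) n)"
      unfolding M_eq by (intro synthesis_diff[OF X, symmetric] s T)
    also have "norm \<dots> \<le> sqrt D * ell2_norm (\<lambda>n. S x n - U (T x) n)"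
      by (intro norm_synthesis_le[OF X] ell2_diff s T)
    also have "\<dots> \<le> sqrt D * ((u * sqrt D + (1 + u) * sqrt lam) * norm x)"
      by (intro mult_left_mono n) (use D in simp)
    finally show ?thesis by (simp add: d_def mult.assoc)
  qed
  have d: "d < C" unfolding d_def u_def by (rule multiplier_constant_bound[OF C CD assms(6)])
  \<comment> \<open>The distance \<open>1 - C / D\<close> of the rescaled frame operator from the
    identity plus the error \<open>d / D\<close> of the multiplier; the sum is below 1 exactly when
    \<open>d < C\<close>.\<close>
  define k where "k = 1 - C / D + d / D"
  have k: "k < 1" using d D by (simp add: k_def divide_strict_right_mono)
  have near: "norm (x - (1 / D) *\<^sub>R M x) \<le> k * norm x" for x
  proof -
    have "x - (1 / D) *\<^sub>R M x
        = (x - (1 / D) *\<^sub>R synthesis smul X (S x)) + (1 / D) *\<^sub>R (synthesis smul X (S x) - M x)"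
      by (simp add: scaleR_diff_right)
    also have "norm \<dots> \<le> (1 - C / D) * norm x + 1 / D * (d * norm x)"
    proof (rule norm_triangle_mono)
      show "norm (x - (1 / D) *\<^sub>R synthesis smul X (S x)) \<le> (1 - C / D) * norm x"
        unfolding S_def by (rule frame_operator_near_scalar[OF f CD])
      show "norm ((1 / D) *\<^sub>R (synthesis smul X (S x) - M x)) \<le> 1 / D * (d * norm x)"
        using mult_left_mono[OF SM[of x], of "1 / D"] D by simp
    qed
    finally show ?thesis by (simp add: k_def algebra_simps)
  qed
  have lin: "linear M" unfolding M_def by (rule linear_multiplier[OF X Y U])
  note inv = near_scalar_invertible[OF lin D k near]
  \<comment> \<open>Invertibility bounds \<open>norm x\<close> by a multiple of
    \<open>norm (M x)\<close>, and \<open>M\<close> factors through \<open>T\<close>, so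
    \<open>T\<close> is bounded below.\<close>
  have "norm x \<le> (1 / (D * (1 - k)) * sqrt D * (1 + u)) * ell2_norm (T x)" for x
  proof -
    have "norm (M x) \<le> sqrt D * ell2_norm (U (T x))"
      unfolding M_eq by (intro norm_synthesis_le[OF X] adjointable_in_ell2[OF U] T)
    also have "\<dots> \<le> sqrt D * ((1 + u) * ell2_norm (T x))"
      by (intro mult_left_mono U_bound T) (use D in simp)
    finally have "1 / (D * (1 - k)) * norm (M x) \<le> 1 / (D * (1 - k)) * (sqrt D * ((1 + u) * ell2_norm (T x)))"
      by (rule mult_left_mono) (use D k in simp)
    with inv(2)[of x] show ?thesis by (simp add: mult.assoc)
  qed
  then have "standard_frame ip Y"
    unfolding T_def by (rule standard_frame_if_bounded_below[OF Y])
  then show ?thesis using inv(1) by (simp add: M_def)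
qed

end
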